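(* Let $\mathbb{F}_q$ be a finite field, let $m\geq1$, and let $w=(w_0,w_1,\dots,w_m)$ be positive integers with $w_1\leq w_2\leq\cdots\leq w_m$. Assume $\gcd(w_0,w_i,q-1)=1$ for all $1\leq i\leq m$. Let $d\geq1$ be an integer that is a linear combination of $w_0,\dots,w_m$ with nonnegative integer coefficients. Then \[ e_q(d;w_0,w_1,\dots,w_m)\leq\min\left\{p_m,\ \left(\left\lfloor\frac{d-1}{w_1}\right\rfloor+1\right)q^{m-1}+p_{m-2}\right\}. \]
   Context: The weighted projective space $\mathbb{P}(w)$ is the quotient of $\overline{\mathbb{F}_q}^{\,m+1}\setminus\{0\}$ by the action of $\overline{\mathbb{F}_q}^*$ given by $\lambda\cdot(x_0,\dots,x_m)=(\lambda^{w_0}x_0,\dots,\lambda^{w_m}x_m)$. $\mathbb{P}(w)(\mathbb{F}_q)$ is the set of points of $\mathbb{P}(w)$ invariant under the Frobenius $(x_0,\dots,x_m)\mapsto(x_0^q,\dots,x_m^q)$; it has $p_m$ elements, where $p_k:=\frac{q^{k+1}-1}{q-1}$ (so $p_0=1$, $p_{-1}=0$). $\mathbb{F}_q[x_0,\dots,x_m]^w_d$ is the $\mathbb{F}_q$-vector space spanned by the monomials $x_0^{a_0}\cdots x_m^{a_m}$ with $w_0a_0+\cdots+w_ma_m=d$. For $f$ in this space, $V_{\mathbb{P}(w)}(f)(\mathbb{F}_q)$ is the set of points of $\mathbb{P}(w)(\mathbb{F}_q)$ at which $f$ vanishes, and \[e_q(d;w_0,\dots,w_m):=\max\{|V_{\mathbb{P}(w)}(f)(\mathbb{F}_q)|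 : f\in\mathbb{F}_q[x_0,\dots,x_m]^w_d,\ f\neq 0\}.\] *)

theory Defs
  imports
    "HOL-Library.Poly_Mapping"
    "HOL-Library.Cardinality"
    "HOL-Algebra.Algebraic_Closure_Type"
begin

section \<open>Weighted projective space over a finite field\<close>

text \<open>
  The type \<open>'a\<close> of class \<^class>\<open>finite_field\<close> is the field with \<open>q = CARD('a)\<close> elements and
  \<open>'a alg_closure\<close> is its algebraic closure. A vector \<open>(x\<^sub>0, \<dots>, x\<^sub>m)\<close> is a function on \<open>nat\<close> that
  vanishes at every index above \<open>m\<close>; only the weights \<open>w 0, \<dots>, w m\<close> matter.
\<close>

definition nonzero_vectors :: "nat \<Rightarrow> (nat \<Rightarrow> 'a :: finite_field alg_closure) set" where
  "nonzero_vectors m = {x. (\<forall>i>m. x i = 0) \<and> x \<noteq> (\<lambda>_. 0)}"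

definition weighted_scale ::
    "(nat \<Rightarrow> nat) \<Rightarrow> 'a :: finite_field alg_closure \<Rightarrow> (nat \<Rightarrow> 'a alg_closure) \<Rightarrow> (nat \<Rightarrow> 'a alg_closure)"
  where "weighted_scale w l x = (\<lambda>i. l ^ w i * x i)"

definition wproj_rel ::
    "nat \<Rightarrow> (nat \<Rightarrow> nat) \<Rightarrow> (nat \<Rightarrow> 'a :: finite_field alg_closure) rel" where
  "wproj_rel m w = {(x, y). x \<in> nonzero_vectors m \<and> y \<in> nonzero_vectors m \<and>
                            (\<exists>l. l \<noteq> 0 \<and> y = weighted_scale w l x)}"

definition wproj_space ::
    "nat \<Rightarrow> (nat \<Rightarrow> nat) \<Rightarrow> (nat \<Rightarrow> 'a :: finite_field alg_closure) set set" where
  "wproj_space m w = nonzero_vectors m // wproj_rel m w"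

definition frobenius :: "(nat \<Rightarrow> 'a :: finite_field alg_closure) \<Rightarrow> (nat \<Rightarrow> 'a alg_closure)" where
  "frobenius x = (\<lambda>i. x i ^ CARD('a))"

text \<open>The map induced by \<^const>\<open>frobenius\<close> on orbits; see \<open>wproj_frobenius_class\<close> below.\<close>

definition wproj_frobenius ::
    "nat \<Rightarrow> (nat \<Rightarrow> nat) \<Rightarrow> (nat \<Rightarrow> 'a :: finite_field alg_closure) set \<Rightarrow> (nat \<Rightarrow> 'a alg_closure) set"
  where "wproj_frobenius m w P = wproj_rel m w `` (frobenius ` P)"

definition rational_points ::
    "nat \<Rightarrow> (nat \<Rightarrow> nat) \<Rightarrow> (nat \<Rightarrow> 'a :: finite_field alg_closure) set set" where
  "rational_points m w = {P \<in> wproj_space m w. wproj_frobenius m w P = P}"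


section \<open>Weighted homogeneous polynomials\<close>

text \<open>
  A multivariate polynomial is a finitely supported map from exponent vectors to coefficients.
\<close>

type_synonym 'a mpoly = "(nat \<Rightarrow>\<^sub>0 nat) \<Rightarrow>\<^sub>0 'a"

definition mpoly_scale :: "'a :: finite_field \<Rightarrow> 'a mpoly \<Rightarrow> 'a mpoly" where
  "mpoly_scale c f = Poly_Mapping.single 0 c * f"

definition weighted_exponents :: "nat \<Rightarrow> (nat \<Rightarrow> nat) \<Rightarrow> nat \<Rightarrow> (nat \<Rightarrow>\<^sub>0 nat) set" where
  "weighted_exponents m w d =
     {a. Poly_Mapping.keys a \<subseteq> {..m} \<and> (\<Sum>i\<le>m. w i * Poly_Mapping.lookup a i) = d}"

text \<open>The qualified name refers to the type-class based span; HOL-Algebra shadows \<open>module\<close>.\<close>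

definition weighted_forms :: "nat \<Rightarrow> (nat \<Rightarrow> nat) \<Rightarrow> nat \<Rightarrow> 'a :: finite_field mpoly set" where
  "weighted_forms m w d =
     Modules.module.span mpoly_scale ((\<lambda>a. Poly_Mapping.single a 1) ` weighted_exponents m w d)"

definition mpoly_eval :: "'a :: finite_field mpoly \<Rightarrow> (nat \<Rightarrow> 'a alg_closure) \<Rightarrow> 'a alg_closure" where
  "mpoly_eval f x =
     (\<Sum>a\<in>Poly_Mapping.keys f. to_ac (Poly_Mapping.lookup f a) *
        (\<Prod>i\<in>Poly_Mapping.keys a. x i ^ Poly_Mapping.lookup a i))"

text \<open>
  For a weighted form, vanishing does not depend on the representative of the point; see
  \<open>mpoly_eval_weighted_scale\<close> below.
\<close>

definition zero_locus ::
    "nat \<Rightarrow> (nat \<Rightarrow> nat) \<Rightarrow> 'a :: finite_field mpoly \<Rightarrow> (nat \<Rightarrow> 'a alg_closure) set set" where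
  "zero_locus m w f = {P \<in> rational_points m w. \<forall>x\<in>P. mpoly_eval f x = 0}"

definition max_zeros :: "'a :: finite_field itself \<Rightarrow> nat \<Rightarrow> (nat \<Rightarrow> nat) \<Rightarrow> nat \<Rightarrow> nat" where
  "max_zeros _ m w d =
     Max {card (zero_locus m w f) | f :: 'a mpoly. f \<in> weighted_forms m w d \<and> f \<noteq> 0}"

text \<open>
  The division is exact. The index is an integer because the index \<open>-1\<close> (with value 0) occurs.
\<close>

definition proj_count :: "nat \<Rightarrow> int \<Rightarrow> nat" where
  "proj_count q k = (q ^ nat (k + 1) - 1) div (q - 1)"


section \<open>The definitions are well-behaved\<close>

lemma proj_count_geometric:
  assumes "q \<ge> 2"
  shows   "proj_count q (int n - 1) = (\<Sum>i<n. q ^ i)"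
proof -
  have "q ^ n - 1 = (q - 1) * (\<Sum>i<n. q ^ i)"
  proof -
    have "int (q ^ n - 1) = int q ^ n - 1"
      using assms by (simp add: of_nat_diff)
    also have "\<dots> = (int q - 1) * (\<Sum>i<n. int q ^ i)"
      by (rule power_diff_1_eq)
    also have "\<dots> = int ((q - 1) * (\<Sum>i<n. q ^ i))"
      using assms by (simp add: of_nat_diff)
    finally show ?thesis by (simp only: of_nat_eq_iff)
  qed
  thus ?thesis using assms by (simp add: proj_count_def)
qed

lemma weighted_scale_in_nonzero_vectors:
  assumes "x \<in> nonzero_vectors m" "l \<noteq> 0"
  shows   "weighted_scale w l x \<in> nonzero_vectors m"
  using assms by (auto simp: nonzero_vectors_def weighted_scale_def fun_eq_iff)

lemma equiv_wproj_rel: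
  "equiv (nonzero_vectors m) (wproj_rel m w :: (nat \<Rightarrow> 'a :: finite_field alg_closure) rel)"
proof (rule equivI)
  show "wproj_rel m w \<subseteq> (nonzero_vectors m :: (nat \<Rightarrow> 'a alg_closure) set) \<times> nonzero_vectors m"
    by (auto simp: wproj_rel_def)
  show "refl_on (nonzero_vectors m) (wproj_rel m w :: (nat \<Rightarrow> 'a alg_closure) rel)"
    by (auto simp: refl_on_def wproj_rel_def weighted_scale_def intro!: exI[of _ 1])
  show "sym (wproj_rel m w :: (nat \<Rightarrow> 'a alg_closure) rel)"
  proof (rule symI)
    fix x y :: "nat \<Rightarrow> 'a alg_closure"
    assume "(x, y) \<in> wproj_rel m w"
    then obtain l :: "'a alg_closure" where l: "x \<in> nonzero_vectors m" "y \<in> nonzero_vectors m" "l \<noteq> 0"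
        "y = weighted_scale w l x"
      by (auto simp: wproj_rel_def)
    have "x = weighted_scale w (inverse l) y"
      using l by (auto simp: weighted_scale_def fun_eq_iff field_simps)
    moreover have "inverse l \<noteq> 0" using l(3) by simp
    ultimately show "(y, x) \<in> wproj_rel m w"
      using l(1,2) unfolding wproj_rel_def by blast
  qed
  show "trans (wproj_rel m w :: (nat \<Rightarrow> 'a alg_closure) rel)"
  proof (rule transI)
    fix x y z :: "nat \<Rightarrow> 'a alg_closure"
    assume "(x, y) \<in> wproj_rel m w" "(y, z) \<in> wproj_rel m w"
    then obtain k l where *: "x \<in> nonzero_vectors m" "z \<in> nonzero_vectors m" "k \<noteq> 0" "l \<noteq> 0"
        "y = weighted_scale w k x" "z = weighted_scale w l y"
      by (auto simp: wproj_rel_def)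
    have "z = weighted_scale w (l * k) x"
      using * by (simp add: weighted_scale_def fun_eq_iff power_mult_distrib mult_ac)
    moreover have "l * k \<noteq> 0" using *(3,4) by simp
    ultimately show "(x, z) \<in> wproj_rel m w"
      using *(1,2) unfolding wproj_rel_def by blast
  qed
qed

lemma frobenius_weighted_scale:
  fixes x :: "nat \<Rightarrow> 'a :: finite_field alg_closure"
  shows "frobenius (weighted_scale w l x) = weighted_scale w (l ^ CARD('a)) (frobenius x)"
  by (simp add: frobenius_def weighted_scale_def power_mult_distrib mult.commute flip: power_mult)

lemma wproj_frobenius_class:
  fixes x :: "nat \<Rightarrow> 'a :: finite_field alg_closure"
  assumes "x \<in> nonzero_vectors m"
  shows   "wproj_frobenius m w (wproj_rel m w `` {x}) = wproj_rel m w `` {frobenius x}"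
proof -
  note eq = equiv_wproj_rel[of m w, where ?'a = 'a]
  have nz: "frobenius y \<in> nonzero_vectors m" if "y \<in> nonzero_vectors m" for y :: "nat \<Rightarrow> 'a alg_closure"
    using that by (auto simp: nonzero_vectors_def frobenius_def fun_eq_iff zero_power)
  have "wproj_rel m w `` {frobenius y} = wproj_rel m w `` {frobenius x}"
    if y: "(x, y) \<in> wproj_rel m w" for y
  proof -
    from y obtain l where l: "l \<noteq> 0" "y = weighted_scale w l x" "y \<in> nonzero_vectors m"
      by (auto simp: wproj_rel_def)
    have "(frobenius x, frobenius y) \<in> wproj_rel m w"
      using l nz[OF assms] nz[OF l(3)] unfolding wproj_rel_def
      by (auto simp: frobenius_weighted_scale intro!: exI[of _ "l ^ CARD('a)"])
    thus ?thesis using equiv_class_eq[OF eq] by metis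
  qed
  moreover have "(x, x) \<in> wproj_rel m w"
    using eq assms by (simp add: equiv_def refl_on_def)
  ultimately show ?thesis
    unfolding wproj_frobenius_def by blast
qed

lemma module_mpoly_scale: "Modules.module (mpoly_scale :: 'a :: finite_field \<Rightarrow> _)"
  by unfold_locales
     (simp_all add: mpoly_scale_def distrib_left distrib_right single_add mult_single flip: mult.assoc)

lemma lookup_mpoly_scale:
  "Poly_Mapping.lookup (mpoly_scale c f) a = c * Poly_Mapping.lookup f a"
proof -
  have "mpoly_scale c f = Poly_Mapping.map ((*) c) f"
    unfolding mpoly_scale_def by (rule mult_map_scale_conv_mult[symmetric])
  thus ?thesis by (simp add: map.rep_eq when_def)
qed

lemma weighted_forms_iff:
  fixes f :: "'a :: finite_field mpoly"
  shows "f \<in> weighted_forms m w d \<longleftrightarrow> Poly_Mapping.keys f \<subseteq> weighted_exponents m w d"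
proof -
  interpret M: Modules.module "mpoly_scale :: 'a \<Rightarrow> _" by (rule module_mpoly_scale)
  let ?E = "weighted_exponents m w d"
  show ?thesis
  proof
    assume "f \<in> weighted_forms m w d"
    moreover have "M.subspace {f :: 'a mpoly. Poly_Mapping.keys f \<subseteq> ?E}"
      unfolding M.subspace_def
      by (auto simp: in_keys_iff lookup_add lookup_mpoly_scale subset_iff) (metis add_0)
    moreover have "(\<lambda>a. Poly_Mapping.single a (1 :: 'a)) ` ?E \<subseteq> {f. Poly_Mapping.keys f \<subseteq> ?E}"
      by auto
    ultimately show "Poly_Mapping.keys f \<subseteq> ?E"
      using M.span_minimal[of "(\<lambda>a. Poly_Mapping.single a 1) ` ?E" "{f. Poly_Mapping.keys f \<subseteq> ?E}"]
      unfolding weighted_forms_def by blast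
  next
    assume f: "Poly_Mapping.keys f \<subseteq> ?E"
    have "f = (\<Sum>a\<in>Poly_Mapping.keys f. mpoly_scale (Poly_Mapping.lookup f a) (Poly_Mapping.single a 1))"
      by (rule poly_mapping_eqI)
         (auto simp: lookup_sum lookup_mpoly_scale lookup_single when_def in_keys_iff
            if_distrib[of "(*) _"] cong: if_cong)
    also have "\<dots> \<in> weighted_forms m w d"
      unfolding weighted_forms_def using f
      by (intro M.span_sum M.span_scale M.span_base) auto
    finally show "f \<in> weighted_forms m w d" .
  qed
qed

lemma mpoly_eval_weighted_scale:
  assumes "f \<in> weighted_forms m w d"
  shows   "mpoly_eval f (weighted_scale w l x) = l ^ d * mpoly_eval f x"
proof -
  have "(\<Prod>i\<in>Poly_Mapping.keys a. (l ^ w i * x i) ^ Poly_Mapping.lookup a i) =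
        l ^ d * (\<Prod>i\<in>Poly_Mapping.keys a. x i ^ Poly_Mapping.lookup a i)"
    if "a \<in> Poly_Mapping.keys f" for a
  proof -
    have a: "Poly_Mapping.keys a \<subseteq> {..m}" "(\<Sum>i\<le>m. w i * Poly_Mapping.lookup a i) = d"
      using assms that by (auto simp: weighted_forms_iff weighted_exponents_def)
    have "(\<Sum>i\<in>Poly_Mapping.keys a. w i * Poly_Mapping.lookup a i) = d"
      unfolding a(2)[symmetric] using a(1) by (intro sum.mono_neutral_left) (auto simp: in_keys_iff)
    hence "(\<Prod>i\<in>Poly_Mapping.keys a. l ^ (w i * Poly_Mapping.lookup a i)) = l ^ d"
      by (simp only: power_sum[symmetric])
    thus ?thesis
      by (simp only: power_mult_distrib prod.distrib power_mult[symmetric])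
  qed
  thus ?thesis
    by (simp add: mpoly_eval_def weighted_scale_def sum_distrib_left mult_ac)
qed

end

theory Submission
  imports Defs
begin

text \<open>
  Write \<open>q\<close> for the size of the field and \<open>k = \<lfloor>(d - 1) / w\<^sub>1\<rfloor> + 1\<close>, so that \<open>d \<le> k w\<^sub>1\<close>. By Hilbert 90
  every rational point has at least \<open>q - 1\<close> representatives with coordinates in the base field, so the
  claim is that a weighted form has at least \<open>(q - 1) (q + 1 - k) q\<^sup>m\<^sup>-\<^sup>1\<close> nonzeros among the
  \<open>q\<^sup>m\<^sup>+\<^sup>1\<close> vectors over the base field, if \<open>k \<le> q\<close>; for \<open>k > q\<close> the bound is trivial.

  Each of the \<open>q - 1\<close> slices \<open>x\<^sub>0 = y \<noteq> 0\<close> of the form has ordinary degree at most \<open>k\<close>. If it has a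
  lexicographically leading monomial of degree less than \<open>k\<close> for some order of the variables, the
  footprint bound gives \<open>(q + 1 - k) q\<^sup>m\<^sup>-\<^sup>1\<close> nonzeros in each slice, which suffices. This covers all
  forms except those with \<open>d = k w\<^sub>1\<close> that involve, besides \<open>x\<^sub>0\<close>, only variables of weight \<open>w\<^sub>1\<close>. For these,
  the ordinary homogenisations of the slices are forms of degree \<open>k\<close> that all restrict to the slice
  \<open>x\<^sub>0 = 0\<close> on the hyperplane at infinity. Serre's bound for each of them, summed over \<open>y\<close>, is the claim.

  For Serre's bound, if the form vanishes on some graph \<open>x\<^sub>i = l(x)\<close> of a linear form in the remaining
  variables, then splitting off the factor \<open>x\<^sub>i - l(x)\<close> lowers the degree, and the Schwartz--Zippel bound
  applies to the parallel translates of this hyperplane. Otherwise, average the bound in one variable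
  less over all graphs.
\<close>

section \<open>Counting nonzeros of functions on vectors\<close>

text \<open>An arbitrary index set, rather than an initial segment, lets inductions add or remove
  any one coordinate; the value 0 off \<open>J\<close> makes each vector a unique function.\<close>

definition vecs :: "nat set \<Rightarrow> (nat \<Rightarrow> 'a :: finite_field) set" where
  "vecs J = {x. \<forall>i. i \<notin> J \<longrightarrow> x i = 0}"

definition nz_count :: "nat set \<Rightarrow> ((nat \<Rightarrow> 'a :: finite_field) \<Rightarrow> 'a) \<Rightarrow> nat" where
  "nz_count J F = card {x \<in> vecs J. F x \<noteq> 0}"

lemma vecs_empty: "vecs {} = {\<lambda>_. 0}"
  by (auto simp: vecs_def)

lemma vecs_zero [simp]: "(\<lambda>_. 0) \<in> vecs J"
  by (auto simp: vecs_def)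

lemma vecs_upd: "x \<in> vecs J \<Longrightarrow> x(i := y) \<in> vecs (insert i J)"
  by (auto simp: vecs_def)

lemma vecs_restrict: "x \<in> vecs (insert i J) \<Longrightarrow> x(i := 0) \<in> vecs J"
  by (auto simp: vecs_def)

text \<open>The inverse subtracts \<open>h\<close> of the vector whose coordinate \<open>i\<close>
  is reset to 0. For linear \<open>h\<close>, fixing \<open>y\<close> cuts out one of the parallel
  translates of the hyperplane \<open>x i = h x\<close>.\<close>

lemma bij_betw_shear:
  fixes h :: "(nat \<Rightarrow> 'a :: finite_field) \<Rightarrow> 'a"
  assumes "i \<notin> J"
  shows "bij_betw (\<lambda>(x, y). x(i := h x + y)) (vecs J \<times> UNIV) (vecs (insert i J))"
proof (rule bij_betw_byWitness[where f' = "\<lambda>x. (x(i := 0), x i - h (x(i := 0)))"])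
  have upd: "x(i := 0) = x" if "x \<in> vecs J" for x :: "nat \<Rightarrow> 'a"
    using that assms by (auto simp: vecs_def fun_upd_idem)
  show "\<forall>p\<in>vecs J \<times> UNIV. ((case p of (x, y) \<Rightarrow> x(i := h x + y))(i := 0),
      (case p of (x, y) \<Rightarrow> x(i := h x + y)) i - h ((case p of (x, y) \<Rightarrow> x(i := h x + y))(i := 0))) = p"
    using upd by auto
qed (auto simp: vecs_upd vecs_restrict)

lemma finite_card_vecs:
  assumes "finite J"
  shows "finite (vecs J :: (nat \<Rightarrow> 'a :: finite_field) set) \<and>
         card (vecs J :: (nat \<Rightarrow> 'a) set) = CARD('a) ^ card J"
  using assms
proof (induction J)
  case empty
  thus ?case by (simp add: vecs_empty)
next
  case (insert i J)
  note bij = bij_betw_shear[OF insert.hyps(2), of "\<lambda>_. 0 :: 'a"]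
  show ?case
    using bij_betw_finite[OF bij] bij_betw_same_card[OF bij, symmetric] insert
    by (simp add: card_cartesian_product)
qed

lemma finite_vecs [simp]: "finite J \<Longrightarrow> finite (vecs J)"
  using finite_card_vecs by blast

lemma card_vecs: "finite J \<Longrightarrow> card (vecs J :: (nat \<Rightarrow> 'a :: finite_field) set) = CARD('a) ^ card J"
  using finite_card_vecs by blast

lemma nz_count_le:
  fixes F :: "(nat \<Rightarrow> 'a :: finite_field) \<Rightarrow> 'a"
  assumes "finite J"
  shows "nz_count J F \<le> CARD('a) ^ card J"
  unfolding nz_count_def card_vecs[OF assms, symmetric] using assms by (intro card_mono) auto

lemma nz_count_pos_iff:
  assumes "finite J"
  shows "nz_count J F > 0 \<longleftrightarrow> (\<exists>x\<in>vecs J. F x \<noteq> 0)"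
  unfolding nz_count_def using assms by (auto simp: card_gt_0_iff)

lemma nz_count_shear:
  fixes h F :: "(nat \<Rightarrow> 'a :: finite_field) \<Rightarrow> 'a"
  assumes "finite J" "i \<notin> J"
  shows "nz_count (insert i J) F = (\<Sum>y\<in>UNIV. nz_count J (\<lambda>x. F (x(i := h x + y))))"
proof -
  define g where "g = (\<lambda>(x, y). x(i := h x + y))"
  have "inj_on g (vecs J \<times> UNIV)" "g ` (vecs J \<times> UNIV) = vecs (insert i J)"
    using bij_betw_shear[OF assms(2), of h] by (simp_all add: bij_betw_def g_def)
  hence "bij_betw g {p \<in> vecs J \<times> UNIV. F (g p) \<noteq> 0} {x \<in> vecs (insert i J). F x \<noteq> 0}"
    unfolding bij_betw_def by (auto intro: inj_on_subset)
  hence "nz_count (insert i J) F =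
      card {p \<in> vecs J \<times> UNIV. F ((\<lambda>(x, y). x(i := h x + y)) p) \<noteq> 0}"
    unfolding nz_count_def g_def by (simp add: bij_betw_same_card)
  also have "{p \<in> vecs J \<times> UNIV. F ((\<lambda>(x, y). x(i := h x + y)) p) \<noteq> 0} =
      prod.swap ` (SIGMA y:UNIV. {x \<in> vecs J. F (x(i := h x + y)) \<noteq> 0})"
    by force
  also have "card \<dots> = card (SIGMA y:UNIV. {x \<in> vecs J. F (x(i := h x + y)) \<noteq> 0})"
    by (rule card_image) simp
  also have "\<dots> = (\<Sum>y\<in>UNIV. nz_count J (\<lambda>x. F (x(i := h x + y))))"
    unfolding nz_count_def using assms by (subst card_SigmaI) auto
  finally show ?thesis .
qed

lemma nz_count_slices:
  fixes F :: "(nat \<Rightarrow> 'a :: finite_field) \<Rightarrow> 'a"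
  assumes "finite J" "i \<notin> J"
  shows "nz_count (insert i J) F = (\<Sum>y\<in>UNIV. nz_count J (\<lambda>x. F (x(i := y))))"
  using nz_count_shear[OF assms, of F "\<lambda>_. 0"] by simp

lemma nz_count_fibres:
  fixes F :: "(nat \<Rightarrow> 'a :: finite_field) \<Rightarrow> 'a"
  assumes "finite J" "i \<notin> J"
  shows "nz_count (insert i J) F = (\<Sum>x\<in>vecs J. card {y. F (x(i := y)) \<noteq> 0})"
proof -
  have "nz_count (insert i J) F = (\<Sum>y\<in>UNIV. \<Sum>x\<in>vecs J. if F (x(i := y)) \<noteq> 0 then 1 else 0)"
    unfolding nz_count_slices[OF assms]
    by (intro sum.cong refl) (use assms in \<open>simp add: nz_count_def sum.If_cases Int_def\<close>)
  also have "\<dots> = (\<Sum>x\<in>vecs J. \<Sum>y\<in>UNIV. if F (x(i := y)) \<noteq> 0 then 1 else 0)"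
    by (rule sum.swap)
  also have "\<dots> = (\<Sum>x\<in>vecs J. card {y. F (x(i := y)) \<noteq> 0})"
    by (intro sum.cong refl) (simp add: sum.If_cases)
  finally show ?thesis .
qed

lemma CARD_finite_field_ge_2: "CARD('a :: finite_field) \<ge> 2"
  using card_mono[of UNIV "{0, 1 :: 'a}"] by simp

section \<open>Functions represented by polynomials of bounded degree\<close>

text \<open>Functions given by some polynomial in the variables \<open>J\<close> of total degree at
  most \<open>k\<close>. Representing polynomials are not unique over a finite field, so
  nonvanishing is always stated through values on \<open>vecs J\<close>. Multiplying by one variable
  at a time makes substitution and division provable by rule induction.\<close>

inductive poly_fun :: "nat set \<Rightarrow> nat \<Rightarrow> ((nat \<Rightarrow> 'a :: finite_field) \<Rightarrow> 'a) \<Rightarrow> bool"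
  for J where
  const: "poly_fun J k (\<lambda>_. c)"
| add: "poly_fun J k F \<Longrightarrow> poly_fun J k G \<Longrightarrow> poly_fun J k (\<lambda>x. F x + G x)"
| coord: "i \<in> J \<Longrightarrow> poly_fun J k F \<Longrightarrow> poly_fun J (Suc k) (\<lambda>x. x i * F x)"

lemma poly_fun_Suc: "poly_fun J k F \<Longrightarrow> poly_fun J (Suc k) F"
  by (induction rule: poly_fun.induct) (auto intro: poly_fun.intros)

lemma poly_fun_mono_set:
  assumes "poly_fun J k F" "J \<subseteq> J'"
  shows "poly_fun J' k F"
  using assms by (induction rule: poly_fun.induct) (auto intro: poly_fun.intros)

lemma poly_fun_cmult: "poly_fun J k F \<Longrightarrow> poly_fun J k (\<lambda>x. c * F x)"
proof (induction rule: poly_fun.induct)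
  case (add k F G)
  thus ?case using poly_fun.add by (simp add: distrib_left)
next
  case (coord i k F)
  thus ?case using poly_fun.coord[of i J k "\<lambda>x. c * F x"] by (simp add: mult.left_commute)
qed (rule poly_fun.const)

lemma poly_fun_sum:
  "(\<And>a. a \<in> A \<Longrightarrow> poly_fun J k (F a)) \<Longrightarrow> poly_fun J k (\<lambda>x. \<Sum>a\<in>A. F a x)"
  by (induction A rule: infinite_finite_induct) (auto intro: poly_fun.intros)

lemma poly_fun_coord_power:
  assumes "i \<in> J" "poly_fun J k F"
  shows "poly_fun J (n + k) (\<lambda>x. x i ^ n * F x)"
proof (induction n)
  case (Suc n)
  show ?case using poly_fun.coord[OF assms(1) Suc] by (simp add: mult.assoc)
qed (use assms in simp)

lemma poly_fun_monomial:
  assumes "finite I" "I \<subseteq> J"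
  shows "poly_fun J (\<Sum>i\<in>I. e i) (\<lambda>x. \<Prod>i\<in>I. x i ^ e i)"
  using assms
proof (induction I)
  case empty
  thus ?case by (simp add: poly_fun.const)
next
  case (insert i I)
  thus ?case using poly_fun_coord_power[of i J "sum e I" "\<lambda>x. \<Prod>i\<in>I. x i ^ e i" "e i"] by simp
qed

lemma poly_fun_mult_linear:
  assumes "poly_fun J k F"
  shows "poly_fun J (Suc k) (\<lambda>x. ((\<Sum>j\<in>J. c j * x j) + e) * F x)"
proof -
  have "poly_fun J (Suc k) (\<lambda>x. (\<Sum>j\<in>J. c j * (x j * F x)) + e * F x)"
    using assms by (intro poly_fun.add poly_fun_sum poly_fun_cmult poly_fun.coord poly_fun_Suc)
  thus ?thesis by (simp add: distrib_right sum_distrib_right mult.assoc)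
qed

lemma poly_fun_subst:
  assumes "poly_fun (insert i J) k F" "i \<notin> J"
  shows "poly_fun J k (\<lambda>x. F (x(i := (\<Sum>j\<in>J. c j * x j) + e)))"
  using assms(1)
proof (induction rule: poly_fun.induct)
  case (coord j k F)
  show ?case
  proof (cases "j = i")
    case True
    thus ?thesis using poly_fun_mult_linear[OF coord.IH] by simp
  next
    case False
    thus ?thesis using poly_fun.coord[OF _ coord.IH, of j] coord.hyps(1) by simp
  qed
qed (auto intro: poly_fun.intros)

lemma poly_fun_subst_const:
  assumes "poly_fun (insert i J) k F" "i \<notin> J"
  shows "poly_fun J k (\<lambda>x. F (x(i := e)))"
  using poly_fun_subst[OF assms, of "\<lambda>_. 0" e]
  by (simp only: mult_zero_left sum.neutral_const add_0_left)

text \<open>Division with remainder by \<open>x i - l x\<close>, which is monic in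
  \<open>x i\<close>. The case \<open>k = 0\<close> is separate because truncated subtraction would
  otherwise allow a nonzero constant quotient.\<close>

lemma poly_fun_divide:
  fixes c :: "nat \<Rightarrow> 'a :: finite_field" and e :: 'a
  assumes "poly_fun (insert i J) k F" "i \<notin> J"
  defines "l \<equiv> (\<lambda>x. (\<Sum>j\<in>J. c j * x j) + e)"
  shows "\<exists>H. (k > 0 \<longrightarrow> poly_fun (insert i J) (k - 1) H) \<and> (k = 0 \<longrightarrow> H = (\<lambda>_. 0)) \<and>
             (\<forall>x. F x = F (x(i := l x)) + (x i - l x) * H x)"
  using assms(1)
proof (induction rule: poly_fun.induct)
  case (const k c)
  show ?case by (rule exI[of _ "\<lambda>_. 0"]) (auto intro: poly_fun.const)
next
  case (add k F G)
  from add.IH obtain H1 H2 where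
    H1: "k > 0 \<longrightarrow> poly_fun (insert i J) (k - 1) H1" "k = 0 \<longrightarrow> H1 = (\<lambda>_. 0)"
        "\<And>x. F x = F (x(i := l x)) + (x i - l x) * H1 x" and
    H2: "k > 0 \<longrightarrow> poly_fun (insert i J) (k - 1) H2" "k = 0 \<longrightarrow> H2 = (\<lambda>_. 0)"
        "\<And>x. G x = G (x(i := l x)) + (x i - l x) * H2 x"
    by blast
  have eq: "F x + G x = F (x(i := l x)) + G (x(i := l x)) + (x i - l x) * (H1 x + H2 x)" for x
    by (subst H1(3), subst H2(3)) (simp add: distrib_left)
  have "k > 0 \<longrightarrow> poly_fun (insert i J) (k - 1) (\<lambda>x. H1 x + H2 x)"
    using H1(1) H2(1) by (blast intro: poly_fun.add)
  moreover have "k = 0 \<longrightarrow> (\<lambda>x. H1 x + H2 x) = (\<lambda>_. 0)" using H1(2) H2(2) by simp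
  ultimately show ?case using eq by blast
next
  case (coord j k F)
  then obtain H where H: "k > 0 \<longrightarrow> poly_fun (insert i J) (k - 1) H" "k = 0 \<longrightarrow> H = (\<lambda>_. 0)"
     "\<And>x. F x = F (x(i := l x)) + (x i - l x) * H x" by blast
  have jH: "poly_fun (insert i J) k (\<lambda>x. x j * H x)"
    using H(1,2) coord.hyps(1) poly_fun.coord[of j "insert i J" "k - 1" H]
    by (cases k) (auto intro: poly_fun.const)
  show ?case
  proof (cases "j = i")
    case True
    \<comment> \<open>With x for \<open>x i\<close> and F(l) for the substituted function, x F = l
      F(l) + (x - l) (F(l) + x H); this is the origin of the new quotient.\<close>
    have "poly_fun J k (\<lambda>x. F (x(i := l x)))"
      unfolding l_def by (rule poly_fun_subst[OF coord.hyps(2) assms(2)])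
    hence "poly_fun (insert i J) k (\<lambda>x. F (x(i := l x)))"
      by (rule poly_fun_mono_set) auto
    hence "Suc k > 0 \<longrightarrow> poly_fun (insert i J) (Suc k - 1) (\<lambda>x. F (x(i := l x)) + x i * H x)"
      using jH True by (auto intro: poly_fun.add)
    moreover have "Suc k = 0 \<longrightarrow> (\<lambda>x. F (x(i := l x)) + x i * H x) = (\<lambda>_. 0)" by simp
    moreover have "\<forall>x. x j * F x = (x(i := l x)) j * F (x(i := l x)) + (x i - l x) * (F (x(i := l x)) + x i * H x)"
      by (intro allI, subst H(3)) (simp add: True algebra_simps)
    ultimately show ?thesis by (intro exI[of _ "\<lambda>x. F (x(i := l x)) + x i * H x"] conjI)
  next
    case False
    have "\<forall>x. x j * F x = (x(i := l x)) j * F (x(i := l x)) + (x i - l x) * (x j * H x)"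
      by (intro allI, subst H(3)) (simp add: False algebra_simps)
    moreover have "Suc k > 0 \<longrightarrow> poly_fun (insert i J) (Suc k - 1) (\<lambda>x. x j * H x)"
      using jH by simp
    moreover have "Suc k = 0 \<longrightarrow> (\<lambda>x. x j * H x) = (\<lambda>_. 0)" by simp
    ultimately show ?thesis by (intro exI[of _ "\<lambda>x. x j * H x"] conjI)
  qed
qed

text \<open>The remainder is the value on the graph, hence vanishes; a nonzero value of
  \<open>F\<close> then excludes the zero quotient that goes with \<open>k = 0\<close>.\<close>

lemma poly_fun_divide_root:
  fixes F :: "(nat \<Rightarrow> 'a :: finite_field) \<Rightarrow> 'a"
  assumes "poly_fun (insert i J) k F" "i \<notin> J" "\<And>x. x \<in> vecs J \<Longrightarrow> F (x(i := (\<Sum>j\<in>J. c j * x j) + e)) = 0"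
          "\<exists>x\<in>vecs (insert i J). F x \<noteq> 0"
  obtains H where "k > 0" "poly_fun (insert i J) (k - 1) H"
    "\<And>x. x \<in> vecs (insert i J) \<Longrightarrow> F x = (x i - ((\<Sum>j\<in>J. c j * x j) + e)) * H x"
proof -
  let ?l = "\<lambda>x. (\<Sum>j\<in>J. c j * x j) + e"
  from poly_fun_divide[OF assms(1,2), of c e] obtain H where
    H: "k > 0 \<longrightarrow> poly_fun (insert i J) (k - 1) H" "k = 0 \<longrightarrow> H = (\<lambda>_. 0)"
       "\<And>x. F x = F (x(i := ?l x)) + (x i - ?l x) * H x"
    by blast
  have eq: "F x = (x i - ?l x) * H x" if "x \<in> vecs (insert i J)" for x
  proof -
    have "?l (x(i := 0)) = ?l x"
      using assms(2) by (intro arg_cong2[of _ _ _ _ "(+)"] sum.cong) auto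
    with assms(3)[OF vecs_restrict[OF that]] have "F (x(i := ?l x)) = 0" by simp
    thus ?thesis by (subst H(3)) simp
  qed
  moreover from this assms(4) H(2) have "k > 0" by (cases k) auto
  ultimately show ?thesis using H(1) that by blast
qed

section \<open>The Schwartz--Zippel bound\<close>

text \<open>Off the hyperplane \<open>x i = c\<close> the two functions have the same nonzeros, and
  the hyperplane holds only \<open>CARD('a) ^ card J\<close> vectors.\<close>

lemma nz_count_hyperplane_split:
  fixes F :: "(nat \<Rightarrow> 'a :: finite_field) \<Rightarrow> 'a"
  assumes "finite J" "i \<notin> J" "\<And>x. F x = (x i - c) * H x"
  shows "nz_count (insert i J) H \<le> nz_count (insert i J) F + CARD('a) ^ card J"
proof -
  have "nz_count (insert i J) H =
      nz_count J (\<lambda>x. H (x(i := c))) + (\<Sum>y\<in>UNIV - {c}. nz_count J (\<lambda>x. H (x(i := y))))"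
    unfolding nz_count_slices[OF assms(1,2)] by (rule sum.remove) auto
  also have "(\<Sum>y\<in>UNIV - {c}. nz_count J (\<lambda>x. H (x(i := y)))) =
      (\<Sum>y\<in>UNIV - {c}. nz_count J (\<lambda>x. F (x(i := y))))"
    by (intro sum.cong refl) (simp add: assms(3) nz_count_def)
  also have "\<dots> \<le> nz_count (insert i J) F"
    unfolding nz_count_slices[OF assms(1,2)] by (rule sum_mono2) auto
  finally show ?thesis using nz_count_le[OF assms(1), of "\<lambda>x. H (x(i := c))"] by linarith
qed

text \<open>Induction on the variables, then on the degree: if no slice \<open>x i = c\<close>
  vanishes identically, the bounds for the slices add up; otherwise a factor \<open>x i - c\<close>
  splits off and the degree drops. The additional factor \<open>CARD('a)\<close> avoids the exponent
  \<open>card J - 1\<close>; for \<open>k \<ge> CARD('a)\<close> truncation makes the left side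
  0.\<close>

lemma schwartz_zippel:
  fixes F :: "(nat \<Rightarrow> 'a :: finite_field) \<Rightarrow> 'a"
  assumes "finite J" "poly_fun J k F" "\<exists>x\<in>vecs J. F x \<noteq> 0"
  shows "(CARD('a) - k) * CARD('a) ^ card J \<le> CARD('a) * nz_count J F"
  using assms
proof (induction J arbitrary: k F rule: finite_induct)
  case empty
  hence "nz_count {} F \<ge> 1" using nz_count_pos_iff[of "{}" F] by simp
  hence "CARD('a) * 1 \<le> CARD('a) * nz_count {} F" by (intro mult_left_mono) auto
  thus ?case by (simp add: diff_le_mono2 order.trans[OF diff_le_self])
next
  case (insert i J)
  let ?q = "CARD('a)"
  show ?case using insert.prems
  proof (induction k arbitrary: F)
    case 0
    have "\<exists>x\<in>vecs J. F (x(i := c)) \<noteq> 0" for c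
    proof (rule ccontr)
      assume neg: "\<not> ?thesis"
      show False
        by (rule poly_fun_divide_root[OF 0(1) insert.hyps(2) _ 0(2), where c = "\<lambda>_. 0" and e = c])
           (use neg in \<open>auto simp only: mult_zero_left sum.neutral_const add_0_left\<close>)
    qed
    hence "(?q - 0) * ?q ^ card J \<le> ?q * nz_count J (\<lambda>x. F (x(i := c)))" for c
      by (intro insert.IH poly_fun_subst_const[OF 0(1) insert.hyps(2)])
    hence "(\<Sum>c\<in>(UNIV :: 'a set). (?q - 0) * ?q ^ card J) \<le> ?q * nz_count (insert i J) F"
      unfolding nz_count_slices[OF insert.hyps(1,2)] sum_distrib_left by (intro sum_mono) auto
    thus ?case using insert.hyps by simp
  next
    case (Suc k)
    show ?case
    proof (cases "\<forall>c. \<exists>x\<in>vecs J. F (x(i := c)) \<noteq> 0")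
      case True
      hence "(?q - Suc k) * ?q ^ card J \<le> ?q * nz_count J (\<lambda>x. F (x(i := c)))" for c
        by (intro insert.IH poly_fun_subst_const[OF Suc.prems(1) insert.hyps(2)]) blast
      hence "(\<Sum>c\<in>(UNIV :: 'a set). (?q - Suc k) * ?q ^ card J) \<le> ?q * nz_count (insert i J) F"
        unfolding nz_count_slices[OF insert.hyps(1,2)] sum_distrib_left by (intro sum_mono) auto
      thus ?thesis using insert.hyps by (simp add: mult_ac)
    next
      case False
      then obtain c where c: "\<And>x. x \<in> vecs J \<Longrightarrow> F (x(i := c)) = 0" by blast
      hence c': "F (x(i := (\<Sum>j\<in>J. 0 * x j) + c)) = 0" if "x \<in> vecs J" for x
        using that by (simp only: mult_zero_left sum.neutral_const add_0_left)
      obtain H where H: "poly_fun (insert i J) k H"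
          "\<And>x. x \<in> vecs (insert i J) \<Longrightarrow> F x = (x i - c) * H x"
        by (rule poly_fun_divide_root[OF Suc.prems(1) insert.hyps(2) c' Suc.prems(2)]) auto
      define F' where "F' = (\<lambda>x. (x i - c) * H x)"
      have FF': "F x = F' x" if "x \<in> vecs (insert i J)" for x
        using H(2)[OF that] by (simp add: F'_def)
      hence nzF: "nz_count (insert i J) F = nz_count (insert i J) F'"
        unfolding nz_count_def by (intro arg_cong[of _ _ card]) auto
      from Suc.prems(2) FF' have "\<exists>x\<in>vecs (insert i J). H x \<noteq> 0"
        by (auto simp: F'_def)
      from Suc.IH[OF H(1) this]
      have "(?q - k) * ?q ^ card (insert i J) \<le> ?q * nz_count (insert i J) H" .
      also have "\<dots> \<le> ?q * (nz_count (insert i J) F + ?q ^ card J)"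
        unfolding nzF by (intro mult_left_mono nz_count_hyperplane_split) (use insert.hyps in \<open>auto simp: F'_def\<close>)
      finally show ?thesis using insert.hyps
        by (simp add: algebra_simps diff_mult_distrib)
    qed
  qed
qed

section \<open>Serre's bound\<close>

lemma dot_upd:
  fixes c :: "nat \<Rightarrow> 'a :: finite_field"
  assumes "finite J" "i \<notin> J"
  shows "(\<Sum>j\<in>insert i J. (c(i := y)) j * x j) = y * x i + (\<Sum>j\<in>J. c j * x j)"
proof -
  have "(\<Sum>j\<in>J. (c(i := y)) j * x j) = (\<Sum>j\<in>J. c j * x j)"
    using assms(2) by (intro sum.cong) auto
  thus ?thesis using assms by simp
qed

text \<open>For fixed nonzero \<open>x\<close>, sending \<open>c\<close> to the dot product is a
  surjective linear form, so all values are taken equally often.\<close>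

lemma dot_equidistributed:
  fixes x :: "nat \<Rightarrow> 'a :: finite_field" and \<phi> :: "'a \<Rightarrow> 'a"
  assumes "finite J" "x \<in> vecs J" "x \<noteq> (\<lambda>_. 0)"
  shows "CARD('a) * nz_count J (\<lambda>c. \<phi> (\<Sum>j\<in>J. c j * x j)) = CARD('a) ^ card J * card {y. \<phi> y \<noteq> 0}"
proof -
  from assms(2,3) obtain i where i: "i \<in> J" "x i \<noteq> 0" by (auto simp: vecs_def fun_eq_iff)
  define I where "I = J - {i}"
  have J: "J = insert i I" "finite I" "i \<notin> I" using i assms(1) by (auto simp: I_def)
  \<comment> \<open>Shearing coordinate \<open>i\<close> of \<open>c\<close> by this amount cancels
    the other summands, so the slice index \<open>y\<close> alone determines the dot
    product.\<close>
  have dot: "(\<Sum>j\<in>insert i I. (c(i := - (\<Sum>j\<in>I. c j * x j) / x i + y)) j * x j) = y * x i" for c y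
    unfolding dot_upd[OF J(2,3)] using i(2) by (simp add: field_simps)
  have "nz_count J (\<lambda>c. \<phi> (\<Sum>j\<in>J. c j * x j)) =
      (\<Sum>y\<in>UNIV. nz_count I (\<lambda>c. \<phi> (y * x i)))"
    unfolding J(1) nz_count_shear[OF J(2,3), of _ "\<lambda>c. - (\<Sum>j\<in>I. c j * x j) / x i"]
    by (simp only: dot)
  also have "\<dots> = (\<Sum>y\<in>UNIV. if \<phi> (y * x i) \<noteq> 0 then CARD('a) ^ card I else 0)"
    by (intro sum.cong refl) (simp add: nz_count_def card_vecs[OF J(2)])
  also have "\<dots> = (\<Sum>y\<in>UNIV. if \<phi> y \<noteq> 0 then CARD('a) ^ card I else 0)"
    by (rule sum.reindex_bij_witness[of _ "\<lambda>y. y / x i" "\<lambda>y. y * x i"]) (use i(2) in auto)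
  also have "\<dots> = card {y. \<phi> y \<noteq> 0} * CARD('a) ^ card I"
    by (simp add: sum.If_cases)
  finally show ?thesis using J by simp
qed

text \<open>Serre's bound on the affine cone: with n = \<open>card J\<close>, at least (q - 1) (q +
  1 - k) q^(n-2) nonzeros, multiplied by q^2 to keep exponents natural. Homogeneity enters as
  invariance of the nonzero set under scalars, which restrictions to hyperplanes through the origin
  inherit.\<close>

lemma nz_count_cone:
  fixes G :: "(nat \<Rightarrow> 'a :: finite_field) \<Rightarrow> 'a"
  assumes "finite J" "poly_fun J k G" "\<exists>x\<in>vecs J. G x \<noteq> 0" "G (\<lambda>_. 0) = 0"
    and cone: "\<And>t x. t \<noteq> 0 \<Longrightarrow> G x \<noteq> 0 \<Longrightarrow> G (\<lambda>j. t * x j) \<noteq> 0"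
    and k: "1 \<le> k"
  shows "(CARD('a) - 1) * (CARD('a) - (k - 1)) * CARD('a) ^ card J \<le> CARD('a)\<^sup>2 * nz_count J G"
  using assms(1-5)
proof (induction J arbitrary: G rule: finite_induct)
  case empty
  thus ?case by (simp add: vecs_empty)
next
  case (insert i J)
  let ?q = "CARD('a)"
  let ?l = "\<lambda>c x. \<Sum>j\<in>J. c j * x j"
  let ?B = "(?q - 1) * (?q - (k - 1))"
  note ins = insert.hyps(1,2)
  have l_upd: "?l c (x(i := y)) = ?l c x" for c x and y :: 'a
    using ins by (intro sum.cong) auto
  have l_scale: "?l c (\<lambda>j. t * x j) = t * ?l c x" for c x and t :: 'a
    by (simp add: sum_distrib_left mult.left_commute)
  show ?case
  proof (cases "\<forall>c. \<exists>x\<in>vecs J. G (x(i := ?l c x)) \<noteq> 0")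
    case True
    have IH: "?B * ?q ^ card J \<le> ?q\<^sup>2 * nz_count J (\<lambda>x. G (x(i := ?l c x)))" for c
    proof (rule insert.IH)
      show "poly_fun J k (\<lambda>x. G (x(i := ?l c x)))"
        using poly_fun_subst[OF insert.prems(1) ins(2), of c 0] by (simp only: add_0_right)
      show "G ((\<lambda>_. 0)(i := ?l c (\<lambda>_. 0))) = 0"
        using insert.prems(3) by (simp add: fun_upd_idem)
      show "G ((\<lambda>j. t * x j)(i := ?l c (\<lambda>j. t * x j))) \<noteq> 0"
        if "t \<noteq> 0" "G (x(i := ?l c x)) \<noteq> 0" for t x
      proof -
        have "(\<lambda>j. t * x j)(i := ?l c (\<lambda>j. t * x j)) = (\<lambda>j. t * (x(i := ?l c x)) j)"
          by (auto simp: fun_eq_iff l_scale)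
        thus ?thesis using insert.prems(4)[OF that] by simp
      qed
    qed (use True in blast)
    \<comment> \<open>Double counting of pairs \<open>(c, x)\<close>: for nonzero \<open>x\<close>
      the height \<open>?l c x\<close> is equidistributed in \<open>c\<close>, so a graph contains
      on average at most a 1/q share of the nonzeros. The origin contributes none because
      \<open>G\<close> vanishes there.\<close>
    have "?q * (\<Sum>c\<in>vecs J. nz_count J (\<lambda>x. G (x(i := ?l c x)))) =
        ?q * (\<Sum>c\<in>vecs J. \<Sum>x\<in>vecs J. if G (x(i := ?l c x)) \<noteq> 0 then 1 else 0)"
      by (intro arg_cong2[of _ _ _ _ "(*)"] sum.cong refl)
         (use ins in \<open>simp add: nz_count_def sum.If_cases Int_def\<close>)
    also have "\<dots> = (\<Sum>x\<in>vecs J. ?q * (\<Sum>c\<in>vecs J. if G (x(i := ?l c x)) \<noteq> 0 then 1 else 0))"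
      by (subst sum.swap) (simp add: sum_distrib_left)
    also have "\<dots> = (\<Sum>x\<in>vecs J. ?q * nz_count J (\<lambda>c. G (x(i := ?l c x))))"
      by (intro arg_cong2[of _ _ _ _ "(*)"] sum.cong refl)
         (use ins in \<open>simp add: nz_count_def sum.If_cases Int_def\<close>)
    also have "\<dots> \<le> (\<Sum>x\<in>vecs J. ?q ^ card J * card {y. G (x(i := y)) \<noteq> 0})"
    proof (rule sum_mono)
      fix x :: "nat \<Rightarrow> 'a"
      assume x: "x \<in> vecs J"
      show "?q * nz_count J (\<lambda>c. G (x(i := ?l c x))) \<le> ?q ^ card J * card {y. G (x(i := y)) \<noteq> 0}"
      proof (cases "x = (\<lambda>_. 0)")
        case True
        thus ?thesis using insert.prems(3) by (simp add: nz_count_def fun_upd_idem)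
      next
        case False
        thus ?thesis using dot_equidistributed[OF ins(1) x, of "\<lambda>y. G (x(i := y))"] by simp
      qed
    qed
    also have "\<dots> = ?q ^ card J * nz_count (insert i J) G"
      by (simp add: nz_count_fibres[OF ins] sum_distrib_left)
    finally have le: "?q * (\<Sum>c\<in>vecs J. nz_count J (\<lambda>x. G (x(i := ?l c x)))) \<le>
        ?q ^ card J * nz_count (insert i J) G" .
    have "?q ^ card J * (?q * (?B * ?q ^ card J)) =
        ?q * (\<Sum>c\<in>(vecs J :: (nat \<Rightarrow> 'a) set). ?B * ?q ^ card J)"
      by (simp add: card_vecs[OF ins(1)] mult_ac)
    also have "\<dots> \<le> ?q * (\<Sum>c\<in>vecs J. ?q\<^sup>2 * nz_count J (\<lambda>x. G (x(i := ?l c x))))"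
      by (intro mult_left_mono sum_mono IH) auto
    also have "\<dots> = ?q\<^sup>2 * (?q * (\<Sum>c\<in>vecs J. nz_count J (\<lambda>x. G (x(i := ?l c x)))))"
      by (simp add: sum_distrib_left mult_ac)
    also have "\<dots> \<le> ?q\<^sup>2 * (?q ^ card J * nz_count (insert i J) G)"
      by (intro mult_left_mono le) auto
    finally have "?q ^ card J * (?q * (?B * ?q ^ card J)) \<le> ?q ^ card J * (?q\<^sup>2 * nz_count (insert i J) G)"
      by (simp only: mult_ac)
    hence "?q * (?B * ?q ^ card J) \<le> ?q\<^sup>2 * nz_count (insert i J) G"
      by (simp only: mult_le_cancel1) simp
    thus ?thesis using ins by (simp add: mult_ac)
  next
    case False
    then obtain c where c: "\<And>x. x \<in> vecs J \<Longrightarrow> G (x(i := ?l c x + 0)) = 0" by auto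
    obtain H where H: "poly_fun (insert i J) (k - 1) H"
        "\<And>x. x \<in> vecs (insert i J) \<Longrightarrow> G x = (x i - (?l c x + 0)) * H x"
      by (rule poly_fun_divide_root[OF insert.prems(1) ins(2) c insert.prems(2)]) auto
    from insert.prems(2) obtain v where v: "v \<in> vecs (insert i J)" "G v \<noteq> 0" by blast
    define y0 where "y0 = v i - ?l c v"
    have y0: "y0 \<noteq> 0" using v H(2)[OF v(1)] by (auto simp: y0_def)
    have slice: "(?q - (k - 1)) * ?q ^ card J \<le> ?q * nz_count J (\<lambda>x. G (x(i := ?l c x + y)))"
      if y: "y \<noteq> 0" for y
    proof -
      have GH: "G (x(i := ?l c x + y)) = y * H (x(i := ?l c x + y))" if "x \<in> vecs J" for x
        using H(2)[OF vecs_upd[OF that], of "?l c x + y"] by (simp only: l_upd) simp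
      \<comment> \<open>Scaling \<open>v\<close> by \<open>y / y0\<close> moves it from the
        translate at height \<open>y0\<close> to the one at height \<open>y\<close>, so
        \<open>H\<close> has a nonzero on every translate with \<open>y \<noteq> 0\<close>.\<close>
      define t where "t = y / y0"
      define x where "x = (\<lambda>j. t * v j)(i := 0)"
      have t: "t \<noteq> 0" using y y0 by (simp add: t_def)
      have x: "x \<in> vecs J" unfolding x_def by (rule vecs_restrict) (use v in \<open>auto simp: vecs_def\<close>)
      have "t * v i = t * ?l c v + y"
        using y0 by (simp add: t_def y0_def field_simps)
      moreover have "?l c x = t * ?l c v" unfolding x_def by (simp only: l_upd l_scale)
      ultimately have "x(i := ?l c x + y) = (\<lambda>j. t * v j)"
        by (simp add: fun_eq_iff) (simp add: x_def)
      with insert.prems(4)[OF t v(2)] GH[OF x] have "H (x(i := ?l c x + y)) \<noteq> 0" by auto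
      hence "(?q - (k - 1)) * ?q ^ card J \<le> ?q * nz_count J (\<lambda>x. H (x(i := ?l c x + y)))"
        by (intro schwartz_zippel poly_fun_subst ins H(1) bexI[OF _ x])
      also have "nz_count J (\<lambda>x. H (x(i := ?l c x + y))) = nz_count J (\<lambda>x. G (x(i := ?l c x + y)))"
        unfolding nz_count_def using GH y by (intro arg_cong[of _ _ card]) auto
      finally show ?thesis .
    qed
    have "(\<Sum>y\<in>UNIV - {0 :: 'a}. (?q - (k - 1)) * ?q ^ card J) \<le>
        (\<Sum>y\<in>UNIV - {0}. ?q * nz_count J (\<lambda>x. G (x(i := ?l c x + y))))"
      by (rule sum_mono) (use slice in auto)
    also have "\<dots> \<le> (\<Sum>y\<in>UNIV. ?q * nz_count J (\<lambda>x. G (x(i := ?l c x + y))))"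
      by (rule sum_mono2) auto
    also have "\<dots> = ?q * nz_count (insert i J) G"
      by (simp add: nz_count_shear[OF ins, of G "?l c"] sum_distrib_left)
    finally have "?B * ?q ^ card J \<le> ?q * nz_count (insert i J) G"
      by (simp add: card_Diff_subset mult_ac)
    hence "?q * (?B * ?q ^ card J) \<le> ?q * (?q * nz_count (insert i J) G)"
      by (rule mult_left_mono) simp
    thus ?thesis using ins by (simp add: mult_ac power2_eq_square)
  qed
qed

section \<open>The footprint bound\<close>

lemma card_nonroots_ge:
  fixes p :: "'a :: finite_field poly"
  assumes "coeff p n \<noteq> 0" "Polynomial.degree p \<le> n"
  shows "CARD('a) - n \<le> card {y. poly p y \<noteq> 0}"
proof -
  have "p \<noteq> 0" using assms(1) by auto
  hence "card {y. poly p y = 0} \<le> n"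
    using card_poly_roots_bound[of p] assms(2) by linarith
  moreover have "{y. poly p y \<noteq> 0} = UNIV - {y. poly p y = 0}" by auto
  ultimately show ?thesis by (simp add: card_Diff_subset)
qed

text \<open>At each \<open>x\<close> the sum is a polynomial in coordinate \<open>i\<close> of
  degree at most \<open>n\<close>; wherever its coefficient at \<open>n\<close> is nonzero, at most
  \<open>n\<close> values of that coordinate are roots.\<close>

lemma footprint_step:
  fixes c :: "'b \<Rightarrow> 'a :: finite_field" and e :: "'b \<Rightarrow> nat \<Rightarrow> nat"
  assumes J: "finite J" "i \<notin> J"
    and A: "finite A" "\<And>a. a \<in> A \<Longrightarrow> e a i \<le> n"
  defines "F \<equiv> \<lambda>K B x. \<Sum>a\<in>B. c a * (\<Prod>j\<in>K. x j ^ e a j)"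
  shows "(CARD('a) - n) * nz_count J (F J {a \<in> A. e a i = n}) \<le> nz_count (insert i J) (F (insert i J) A)"
proof -
  define p where "p = (\<lambda>x. \<Sum>a\<in>A. monom (c a * (\<Prod>j\<in>J. x j ^ e a j)) (e a i))"
  have poly_p: "poly (p x) y = F (insert i J) A (x(i := y))" for x y
  proof -
    have "(\<Prod>j\<in>J. (x(i := y)) j ^ e a j) = (\<Prod>j\<in>J. x j ^ e a j)" for a
      using J by (intro prod.cong) auto
    thus ?thesis using J by (simp add: p_def F_def poly_sum poly_monom mult_ac)
  qed
  have coeff_p: "coeff (p x) n = F J {a \<in> A. e a i = n} x" for x
  proof -
    have "coeff (p x) n = (\<Sum>a\<in>A. if e a i = n then c a * (\<Prod>j\<in>J. x j ^ e a j) else 0)"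
      by (simp add: p_def coeff_sum)
    thus ?thesis using A(1) by (simp add: F_def sum.If_cases Int_def)
  qed
  have deg_p: "Polynomial.degree (p x) \<le> n" for x
    unfolding p_def
    by (intro Polynomial.degree_sum_le A(1) order.trans[OF Polynomial.degree_monom_le] A(2))
  have "(CARD('a) - n) * nz_count J (F J {a \<in> A. e a i = n}) =
      (\<Sum>x\<in>vecs J. if F J {a \<in> A. e a i = n} x \<noteq> 0 then CARD('a) - n else 0)"
    using J(1) by (simp add: nz_count_def sum.If_cases Int_def)
  also have "\<dots> \<le> (\<Sum>x\<in>vecs J. card {y. F (insert i J) A (x(i := y)) \<noteq> 0})"
  proof (rule sum_mono)
    fix x :: "nat \<Rightarrow> 'a"
    show "(if F J {a \<in> A. e a i = n} x \<noteq> 0 then CARD('a) - n else 0) \<le>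
        card {y. F (insert i J) A (x(i := y)) \<noteq> 0}"
      using card_nonroots_ge[OF _ deg_p, of x] by (simp add: poly_p coeff_p)
  qed
  also have "\<dots> = nz_count (insert i J) (F (insert i J) A)"
    by (rule nz_count_fibres[OF J, symmetric])
  finally show ?thesis .
qed

text \<open>Keeping only the terms of largest exponent in \<open>i\<close> is one step towards the
  lexicographically leading monomial. As the exponent of \<open>i\<close> is constant on them, they
  stay distinct after \<open>i\<close> is dropped, which is why \<open>IH\<close> is confined to
  such sets.\<close>

lemma footprint_extend:
  fixes c :: "'b \<Rightarrow> 'a :: finite_field" and e :: "'b \<Rightarrow> nat \<Rightarrow> nat"
  defines "F \<equiv> \<lambda>K B x. \<Sum>a\<in>B. c a * (\<Prod>j\<in>K. x j ^ e a j)"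
  assumes J: "finite J" "i \<notin> J" and A: "finite A" "A \<noteq> {}"
    and IH: "\<And>B. B \<subseteq> A \<Longrightarrow> B \<noteq> {} \<Longrightarrow> (\<And>a b. a \<in> B \<Longrightarrow> b \<in> B \<Longrightarrow> e a i = e b i) \<Longrightarrow>
               \<exists>a\<in>B. (\<Prod>j\<in>J. CARD('a) - e a j) \<le> nz_count J (F J B)"
  shows "\<exists>a\<in>A. (\<forall>b\<in>A. e b i \<le> e a i) \<and>
     (\<Prod>j\<in>insert i J. CARD('a) - e a j) \<le> nz_count (insert i J) (F (insert i J) A)"
proof -
  define n where "n = Max ((\<lambda>a. e a i) ` A)"
  define B where "B = {a \<in> A. e a i = n}"
  have "n \<in> (\<lambda>a. e a i) ` A" unfolding n_def using A by (intro Max_in) auto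
  hence "\<exists>a\<in>B. (\<Prod>j\<in>J. CARD('a) - e a j) \<le> nz_count J (F J B)"
    by (intro IH) (auto simp: B_def)
  then obtain a where a: "a \<in> B" "(\<Prod>j\<in>J. CARD('a) - e a j) \<le> nz_count J (F J B)" by blast
  have n: "e b i \<le> n" if "b \<in> A" for b using that A(1) by (simp add: n_def)
  have "(\<Prod>j\<in>insert i J. CARD('a) - e a j) = (CARD('a) - n) * (\<Prod>j\<in>J. CARD('a) - e a j)"
    using J a(1) by (simp add: B_def)
  also have "\<dots> \<le> (CARD('a) - n) * nz_count J (F J B)"
    by (intro mult_left_mono a(2)) auto
  also have "\<dots> \<le> nz_count (insert i J) (F (insert i J) A)"
    unfolding B_def F_def by (intro footprint_step J n A(1))
  finally show ?thesis using a(1) n by (auto simp: B_def)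
qed

text \<open>The witness constructed is the lexicographically leading monomial; if one of its
  exponents reaches \<open>CARD('a)\<close>, the product is 0 and the bound says nothing.\<close>

lemma footprint_bound:
  fixes c :: "'b \<Rightarrow> 'a :: finite_field" and e :: "'b \<Rightarrow> nat \<Rightarrow> nat"
  assumes "finite J" "finite A" "A \<noteq> {}" "\<And>a. a \<in> A \<Longrightarrow> c a \<noteq> 0"
    and "\<And>a b. a \<in> A \<Longrightarrow> b \<in> A \<Longrightarrow> (\<And>j. j \<in> J \<Longrightarrow> e a j = e b j) \<Longrightarrow> a = b"
  shows "\<exists>a\<in>A. (\<Prod>j\<in>J. CARD('a) - e a j) \<le> nz_count J (\<lambda>x. \<Sum>a\<in>A. c a * (\<Prod>j\<in>J. x j ^ e a j))"
  using assms
proof (induction J arbitrary: A rule: finite_induct)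
  case empty
  then obtain a where "A = {a}" by fastforce
  thus ?case using empty.prems by (simp add: nz_count_def vecs_empty)
next
  case (insert i J)
  have "\<exists>a\<in>B. (\<Prod>j\<in>J. CARD('a) - e a j) \<le> nz_count J (\<lambda>x. \<Sum>a\<in>B. c a * (\<Prod>j\<in>J. x j ^ e a j))"
    if "B \<subseteq> A" "B \<noteq> {}" "\<And>a b. a \<in> B \<Longrightarrow> b \<in> B \<Longrightarrow> e a i = e b i" for B
  proof (rule insert.IH)
    show "finite B" using that(1) insert.prems(1) by (rule finite_subset)
    show "c a \<noteq> 0" if "a \<in> B" for a using that \<open>B \<subseteq> A\<close> insert.prems(3) by blast
    show "a = b" if "a \<in> B" "b \<in> B" "\<And>j. j \<in> J \<Longrightarrow> e a j = e b j" for a b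
      using that \<open>B \<subseteq> A\<close> \<open>\<And>a b. a \<in> B \<Longrightarrow> b \<in> B \<Longrightarrow> e a i = e b i\<close>
      by (intro insert.prems(4)) auto
  qed fact
  from footprint_extend[OF insert.hyps insert.prems(1,2) this] show ?case by blast
qed

text \<open>The monomial realising the bound can be chosen of maximal degree in a prescribed variable,
  because that variable may come first in the lexicographic order.\<close>

lemma footprint_bound_at:
  fixes c :: "'b \<Rightarrow> 'a :: finite_field" and e :: "'b \<Rightarrow> nat \<Rightarrow> nat"
  assumes "finite J" "i \<in> J" "finite A" "A \<noteq> {}" "\<And>a. a \<in> A \<Longrightarrow> c a \<noteq> 0"
    and inj: "\<And>a b. a \<in> A \<Longrightarrow> b \<in> A \<Longrightarrow> (\<And>j. j \<in> J \<Longrightarrow> e a j = e b j) \<Longrightarrow> a = b"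
  shows "\<exists>a\<in>A. (\<forall>b\<in>A. e b i \<le> e a i) \<and>
     (\<Prod>j\<in>J. CARD('a) - e a j) \<le> nz_count J (\<lambda>x. \<Sum>a\<in>A. c a * (\<Prod>j\<in>J. x j ^ e a j))"
proof -
  define I where "I = J - {i}"
  have J: "J = insert i I" "finite I" "i \<notin> I" using assms(1,2) by (auto simp: I_def)
  have "\<exists>a\<in>B. (\<Prod>j\<in>I. CARD('a) - e a j) \<le> nz_count I (\<lambda>x. \<Sum>a\<in>B. c a * (\<Prod>j\<in>I. x j ^ e a j))"
    if "B \<subseteq> A" "B \<noteq> {}" "\<And>a b. a \<in> B \<Longrightarrow> b \<in> B \<Longrightarrow> e a i = e b i" for B
  proof (rule footprint_bound)
    show "finite B" using that(1) assms(3) by (rule finite_subset)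
    show "c a \<noteq> 0" if "a \<in> B" for a using that \<open>B \<subseteq> A\<close> assms(5) by blast
    show "a = b" if "a \<in> B" "b \<in> B" "\<And>j. j \<in> I \<Longrightarrow> e a j = e b j" for a b
      using that \<open>B \<subseteq> A\<close> \<open>\<And>a b. a \<in> B \<Longrightarrow> b \<in> B \<Longrightarrow> e a i = e b i\<close>
      by (intro inj) (auto simp: J(1))
  qed (fact J that)+
  from footprint_extend[OF J(2,3) assms(3,4) this] show ?thesis unfolding J(1) by blast
qed

text \<open>For given total degree the product is smallest when all the degree sits in one variable:
  if s + t \<le> q, then (q - s) (q - t) exceeds q (q - s - t) by s t.\<close>

lemma prod_diff_ge:
  fixes q :: nat
  assumes "finite J"
  shows "(q - (\<Sum>j\<in>J. s j)) * q ^ card J \<le> q * (\<Prod>j\<in>J. q - s j)"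
  using assms
proof (induction J)
  case (insert i J)
  let ?S = "\<Sum>j\<in>J. s j"
  have "q * (q - (s i + ?S)) \<le> (q - s i) * (q - ?S)"
  proof (cases "s i + ?S \<le> q")
    case True
    then obtain r where "q = s i + ?S + r" using le_Suc_ex by blast
    thus ?thesis by (simp add: algebra_simps)
  qed simp
  hence "(q - (\<Sum>j\<in>insert i J. s j)) * q ^ card (insert i J) \<le> (q - s i) * (q - ?S) * q ^ card J"
    using insert.hyps mult_right_mono[of "q * (q - (s i + ?S))" _ "q ^ card J"] by (simp add: mult_ac)
  also have "\<dots> \<le> (q - s i) * (q * (\<Prod>j\<in>J. q - s j))"
    using mult_left_mono[OF insert.IH, of "q - s i"] by (simp add: mult_ac)
  finally show ?case using insert.hyps by (simp add: mult_ac)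
qed simp

section \<open>Nonzeros of weighted forms\<close>

lemma nz_count_scale:
  fixes F :: "(nat \<Rightarrow> 'a :: finite_field) \<Rightarrow> 'a"
  assumes "t \<noteq> 0"
  shows "nz_count J (\<lambda>x. F (\<lambda>j. t * x j)) = nz_count J F"
  unfolding nz_count_def
proof (rule bij_betw_same_card)
  have inv: "(\<lambda>j. t * (x j / t)) = x" for x :: "nat \<Rightarrow> 'a" using assms by auto
  show "bij_betw (\<lambda>x j. t * x j) {x \<in> vecs J. F (\<lambda>j. t * x j) \<noteq> 0} {x \<in> vecs J. F x \<noteq> 0}"
    by (rule bij_betw_byWitness[where f' = "\<lambda>x j. x j / t"])
       (use assms inv in \<open>auto simp: vecs_def\<close>)
qed

lemma nz_count_weighted_form:
  fixes c :: "'b \<Rightarrow> 'a :: finite_field" and e :: "'b \<Rightarrow> nat \<Rightarrow> nat" and w :: "nat \<Rightarrow> nat"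
  assumes m: "m \<ge> 1" and w0: "w 0 > 0" and w1: "w 1 > 0" "\<And>i. 1 \<le> i \<Longrightarrow> i \<le> m \<Longrightarrow> w 1 \<le> w i"
    and A: "finite A" "A \<noteq> {}" "\<And>a. a \<in> A \<Longrightarrow> c a \<noteq> 0"
    and d: "\<And>a. a \<in> A \<Longrightarrow> (\<Sum>i\<le>m. w i * e a i) = d"
    and inj: "\<And>a b. a \<in> A \<Longrightarrow> b \<in> A \<Longrightarrow> (\<And>j. j \<le> m \<Longrightarrow> e a j = e b j) \<Longrightarrow> a = b"
    and k: "1 \<le> k" "k \<le> CARD('a)" "d \<le> k * w 1"
  defines "F \<equiv> \<lambda>x. \<Sum>a\<in>A. c a * (\<Prod>j\<le>m. x j ^ e a j)"
  shows "(CARD('a) - 1) * (CARD('a) - (k - 1)) * CARD('a) ^ (m - 1) \<le> nz_count {..m} F"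
proof -
  let ?q = "CARD('a)"
  define J where "J = {1..m}"
  define S where "S = (\<lambda>a. \<Sum>j\<in>J. e a j)"
  have J: "{..m} = insert 0 J" "finite J" "0 \<notin> J" "card J = m" "1 \<in> J" using m by (auto simp: J_def)
  have qm: "?q ^ m = ?q * ?q ^ (m - 1)" using m by (cases m) auto
  have q: "?q \<ge> 2" by (rule CARD_finite_field_ge_2)
  have d': "w 0 * e a 0 + (\<Sum>j\<in>J. w j * e a j) = d" if "a \<in> A" for a
    using d[OF that] J(2,3) unfolding J(1) by simp
  have w1_le: "w 1 * S a \<le> (\<Sum>j\<in>J. w j * e a j)" for a
    unfolding S_def sum_distrib_left by (intro sum_mono mult_right_mono w1(2)) (auto simp: J_def)
  \<comment> \<open>The weighted degree determines the exponent of \<open>x 0\<close> from the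
    others, so setting \<open>x 0\<close> to a constant merges no two monomials.\<close>
  have inj': "a = b" if "a \<in> A" "b \<in> A" "\<And>j. j \<in> J \<Longrightarrow> e a j = e b j" for a b
  proof (rule inj[OF that(1,2)])
    have "(\<Sum>j\<in>J. w j * e a j) = (\<Sum>j\<in>J. w j * e b j)" using that(3) by (intro sum.cong) auto
    hence "w 0 * e a 0 = w 0 * e b 0" using d'[OF that(1)] d'[OF that(2)] by linarith
    hence "e a 0 = e b 0" using w0 by simp
    thus "e a j = e b j" if "j \<le> m" for j
      using \<open>\<And>j. j \<in> J \<Longrightarrow> e a j = e b j\<close> that by (cases "j = 0") (auto simp: J_def)
  qed
  define P where "P = (\<lambda>y x. \<Sum>a\<in>A. (c a * y ^ e a 0) * (\<Prod>j\<in>J. x j ^ e a j))"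
  have prod_upd: "(\<Prod>j\<in>J. (x(0 := y)) j ^ e a j) = (\<Prod>j\<in>J. x j ^ e a j)" for x a and y :: 'a
    using J(3) by (intro prod.cong) auto
  have F_upd: "F (x(0 := y)) = P y x" for x y
    unfolding F_def P_def J(1)
    by (intro sum.cong refl) (simp only: prod.insert[OF J(2,3)] prod_upd fun_upd_same mult.assoc)
  have nz_F: "nz_count {..m} F = nz_count J (P 0) + (\<Sum>y\<in>UNIV - {0}. nz_count J (P y))"
    unfolding J(1) nz_count_slices[OF J(2,3)] F_upd by (rule sum.remove) auto
  \<comment> \<open>\<open>S a\<close> is the degree of a term in the slices. In the first case some
    variable \<open>i\<close> has all its terms of top degree in \<open>i\<close> of degree below
    \<open>k\<close>, and the footprint bound with \<open>i\<close> in front applies.\<close>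
  show ?thesis
  proof (cases "\<exists>i\<in>J. \<forall>a\<in>A. (\<forall>b\<in>A. e b i \<le> e a i) \<longrightarrow> S a \<le> k - 1")
    case True
    then obtain i where i: "i \<in> J" "\<And>a. a \<in> A \<Longrightarrow> (\<forall>b\<in>A. e b i \<le> e a i) \<Longrightarrow> S a \<le> k - 1"
      by blast
    have "(?q - (k - 1)) * ?q ^ (m - 1) \<le> nz_count J (P y)" if y: "y \<noteq> 0" for y
    proof -
      have "\<exists>a\<in>A. (\<forall>b\<in>A. e b i \<le> e a i) \<and> (\<Prod>j\<in>J. ?q - e a j) \<le> nz_count J (P y)"
        unfolding P_def using y A by (intro footprint_bound_at J(2) i(1) inj') auto
      then obtain a where a: "a \<in> A" "\<forall>b\<in>A. e b i \<le> e a i" "(\<Prod>j\<in>J. ?q - e a j) \<le> nz_count J (P y)"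
        by blast
      have "(?q - (k - 1)) * ?q ^ card J \<le> (?q - S a) * ?q ^ card J"
        using i(2)[OF a(1,2)] by (intro mult_right_mono diff_le_mono2) auto
      also have "\<dots> \<le> ?q * (\<Prod>j\<in>J. ?q - e a j)"
        unfolding S_def by (rule prod_diff_ge[OF J(2)])
      also have "\<dots> \<le> ?q * nz_count J (P y)" by (intro mult_left_mono a(3)) auto
      finally have "?q * ((?q - (k - 1)) * ?q ^ (m - 1)) \<le> ?q * nz_count J (P y)"
        by (simp add: J(4) qm mult_ac)
      thus ?thesis by simp
    qed
    hence "(\<Sum>y\<in>UNIV - {0 :: 'a}. (?q - (k - 1)) * ?q ^ (m - 1)) \<le> (\<Sum>y\<in>UNIV - {0}. nz_count J (P y))"
      by (intro sum_mono) auto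
    thus ?thesis unfolding nz_F by (simp add: card_Diff_subset mult.assoc)
  next
    case False
    from False J(5) obtain a0 where a0: "a0 \<in> A" "S a0 \<ge> k" by fastforce
    \<comment> \<open>A variable \<open>j\<close> of larger weight would lead back to the first
      case: a term of top degree in \<open>j\<close> contains \<open>j\<close>, and spending
      \<open>w j > w 1\<close> there leaves total degree below \<open>k\<close>.\<close>
    have w_eq: "w j = w 1" if aj: "a \<in> A" "j \<in> J" "e a j > 0" for a j
    proof (rule ccontr)
      assume "w j \<noteq> w 1"
      with w1(2)[of j] aj(2) have wj: "w 1 < w j" by (auto simp: J_def)
      have "S b \<le> k - 1" if b: "b \<in> A" "\<forall>a\<in>A. e a j \<le> e b j" for b
      proof -
        have "e b j > 0" using b aj by fastforce
        hence "w 1 * S b < (\<Sum>j\<in>J. w j * e b j)"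
          unfolding S_def sum_distrib_left
          using wj aj(2) w1(2) J(2) by (intro sum_strict_mono_ex1) (auto simp: J_def)
        also have "\<dots> \<le> w 1 * k" using d'[OF b(1)] k(3) by (simp add: mult.commute)
        finally have "S b < k" by simp
        thus ?thesis by linarith
      qed
      with False aj(2) show False by blast
    qed
    have sum_eq: "(\<Sum>j\<in>J. w j * e a j) = w 1 * S a" if "a \<in> A" for a
      unfolding S_def sum_distrib_left using w_eq[OF that] by (intro sum.cong refl) (metis gr0I mult_is_0)
    \<comment> \<open>The term \<open>a0\<close> of degree at least \<open>k\<close> forces
      \<open>d = w 1 * k\<close>; hence no term has degree above \<open>k\<close>, and degree
      \<open>k\<close> means absence of \<open>x 0\<close>.\<close>
    have "w 1 * k \<le> w 1 * S a0" using a0(2) by simp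
    also have "\<dots> \<le> d" using d'[OF a0(1)] w1_le[of a0] by linarith
    finally have dk: "d = w 1 * k" using k(3) by (simp add: mult.commute)
    have wS: "w 0 * e a 0 + w 1 * S a = w 1 * k" if "a \<in> A" for a
      using d'[OF that] sum_eq[OF that] dk by simp
    have S_le: "S a \<le> k" if "a \<in> A" for a
    proof -
      have "w 1 * S a \<le> w 1 * k" using wS[OF that] by linarith
      thus ?thesis using w1(1) by simp
    qed
    have S_eq: "S a = k \<longleftrightarrow> e a 0 = 0" if "a \<in> A" for a
      using wS[OF that] w0 w1(1) by (metis add_cancel_right_left mult_cancel1 mult_eq_0_iff neq0_conv)
    \<comment> \<open>the degree-\<open>k\<close> homogenisation of the slice \<open>x 0 = y\<close>, with \<open>x 0\<close> as homogenising variable\<close>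
    define G where "G = (\<lambda>y x. \<Sum>a\<in>A. (c a * y ^ e a 0) * (x 0 ^ (k - S a) * (\<Prod>j\<in>J. x j ^ e a j)))"
    have G_upd: "G y (x(0 := t)) = (\<Sum>a\<in>A. (c a * y ^ e a 0) * (t ^ (k - S a) * (\<Prod>j\<in>J. x j ^ e a j)))"
      for x y t unfolding G_def by (simp only: prod_upd fun_upd_same)
    have G_1: "G y (x(0 := 1)) = P y x" for x y
      unfolding G_upd P_def by simp
    \<comment> \<open>The part at infinity is the same for all \<open>y\<close>: the terms of degree
      \<open>k\<close> are those without \<open>x 0\<close>, and for them \<open>y ^ e a 0\<close>
      is 1.\<close>
    have G_0: "G y (x(0 := 0)) = P 0 x" for x y
      unfolding G_upd P_def
    proof (intro sum.cong refl)
      fix a assume a: "a \<in> A"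
      show "c a * y ^ e a 0 * (0 ^ (k - S a) * (\<Prod>j\<in>J. x j ^ e a j)) = c a * 0 ^ e a 0 * (\<Prod>j\<in>J. x j ^ e a j)"
        using S_eq[OF a] S_le[OF a] by (cases "e a 0 = 0") (auto simp: power_0_left)
    qed
    have G_scale: "G y (\<lambda>j. t * x j) = t ^ k * G y x" for x y t
    proof -
      have "t ^ (k - S a) * (\<Prod>j\<in>J. t ^ e a j) = t ^ k" if "a \<in> A" for a
        using S_le[OF that] by (simp add: S_def flip: power_sum power_add)
      hence eq: "(c a * y ^ e a 0) * ((t * x 0) ^ (k - S a) * (\<Prod>j\<in>J. (t * x j) ^ e a j)) =
          t ^ k * ((c a * y ^ e a 0) * (x 0 ^ (k - S a) * (\<Prod>j\<in>J. x j ^ e a j)))" if "a \<in> A" for a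
        using that by (simp add: power_mult_distrib prod.distrib mult_ac)
      show ?thesis unfolding G_def sum_distrib_left by (intro sum.cong refl) (rule eq)
    qed
    have G_poly: "poly_fun {..m} k (G y)" for y
      unfolding G_def
    proof (intro poly_fun_sum poly_fun_cmult)
      fix a assume a: "a \<in> A"
      have "poly_fun {..m} (k - S a + S a) (\<lambda>x :: nat \<Rightarrow> 'a. x 0 ^ (k - S a) * (\<Prod>j\<in>J. x j ^ e a j))"
        unfolding S_def by (intro poly_fun_coord_power poly_fun_monomial J(2)) (auto simp: J(1))
      thus "poly_fun {..m} k (\<lambda>x :: nat \<Rightarrow> 'a. x 0 ^ (k - S a) * (\<Prod>j\<in>J. x j ^ e a j))"
        using S_le[OF a] by simp
    qed
    \<comment> \<open>Nonvanishing as a function is delicate only if an exponent reaches q. As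
      exponents are at most \<open>k \<le> ?q\<close>, the term is then a pure power of
      \<open>x j\<close> with \<open>k = ?q\<close>, and the unit vector in direction
      \<open>j\<close> picks out its coefficient.\<close>
    have G_nz: "\<exists>x\<in>vecs {..m}. G y x \<noteq> 0" if y: "y \<noteq> 0" for y
    proof (cases "\<exists>a\<in>A. \<exists>j\<in>J. e a j \<ge> ?q")
      case True
      then obtain a j where aj: "a \<in> A" "j \<in> J" "e a j \<ge> ?q" by blast
      have split: "S b = e b j + (\<Sum>i\<in>J - {j}. e b i)" for b
        unfolding S_def using J(2) aj(2) by (rule sum.remove)
      from split[of a] S_le[OF aj(1)] k(2) aj(3)
      have a: "S a = k" "e a j = k" "(\<Sum>i\<in>J - {j}. e a i) = 0" by linarith+
      define x :: "nat \<Rightarrow> 'a" where "x = (\<lambda>i. if i = j then 1 else 0)"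
      have "j \<noteq> 0" using aj(2) by (auto simp: J_def)
      hence x0: "x 0 = 0" by (simp add: x_def)
      have "x 0 ^ (k - S b) * (\<Prod>j\<in>J. x j ^ e b j) = (if b = a then 1 else 0)" if b: "b \<in> A" for b
      proof (cases "S b = k \<and> (\<forall>i\<in>J - {j}. e b i = 0)")
        case True
        have "b = a"
        proof (rule inj'[OF b aj(1)])
          fix i assume "i \<in> J"
          thus "e b i = e a i" using True split[of b] a J(2) by (cases "i = j") auto
        qed
        moreover have "(\<Prod>j\<in>J. x j ^ e b j) = 1"
          using True by (intro prod.neutral) (auto simp: x_def)
        ultimately show ?thesis using True by simp
      next
        case False
        have "\<forall>i\<in>J - {j}. e a i = 0" using a(3) J(2) by simp
        hence "b \<noteq> a" using False a(1) by blast
        moreover have "x 0 ^ (k - S b) = 0 \<or> (\<Prod>j\<in>J. x j ^ e b j) = 0"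
        proof (cases "S b = k")
          case True
          with False obtain i where "i \<in> J" "i \<noteq> j" "e b i \<noteq> 0" by blast
          thus ?thesis using J(2) by (auto simp: x_def intro!: bexI[of _ i])
        next
          case False
          thus ?thesis using S_le[OF b] x0 by simp
        qed
        ultimately show ?thesis by auto
      qed
      hence "G y x = (\<Sum>b\<in>A. (c b * y ^ e b 0) * (if b = a then 1 else 0))"
        unfolding G_def by (intro sum.cong refl) simp
      also have "\<dots> = (\<Sum>b\<in>A. if b = a then c a * y ^ e a 0 else 0)" by (intro sum.cong) auto
      also have "\<dots> = c a * y ^ e a 0" using aj(1) A(1) by simp
      finally have "G y x \<noteq> 0" using y A(3)[OF aj(1)] by simp
      moreover have "x \<in> vecs {..m}" using aj(2) by (auto simp: x_def vecs_def J_def)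
      ultimately show ?thesis by blast
    next
      case False
      have "\<exists>a\<in>A. (\<Prod>j\<in>J. ?q - e a j) \<le> nz_count J (P y)"
        unfolding P_def using y A by (intro footprint_bound J(2) inj') auto
      then obtain a where a: "a \<in> A" "(\<Prod>j\<in>J. ?q - e a j) \<le> nz_count J (P y)" by blast
      have "(\<Prod>j\<in>J. ?q - e a j) > 0" using False a(1) by (intro prod_pos) (auto simp: not_le)
      with a(2) obtain x where x: "x \<in> vecs J" "P y x \<noteq> 0"
        using nz_count_pos_iff[OF J(2), of "P y"] by auto
      have "x(0 := 1) \<in> vecs {..m}" unfolding J(1) by (rule vecs_upd[OF x(1)])
      moreover have "G y (x(0 := 1)) \<noteq> 0" using x(2) by (simp only: G_1) simp
      ultimately show ?thesis by blast
    qed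
    have G_cone: "(?q - 1) * (?q - (k - 1)) * ?q ^ card {..m} \<le> ?q\<^sup>2 * nz_count {..m} (G y)"
      if y: "y \<noteq> 0" for y
    proof (rule nz_count_cone[OF _ G_poly G_nz[OF y] _ _ k(1)])
      show "G y (\<lambda>_. 0) = 0" using G_scale[of y 0 "\<lambda>_. 0"] k(1) by (simp add: power_0_left)
      show "G y (\<lambda>j. t * x j) \<noteq> 0" if "t \<noteq> 0" "G y x \<noteq> 0" for t x
        using that by (simp add: G_scale)
    qed simp
    have nz_slice: "nz_count J (\<lambda>x. G y (x(0 := t))) = nz_count J (P y)" if t: "t \<noteq> 0" for t y
    proof -
      have upd: "(\<lambda>j. t * x j)(0 := t) = (\<lambda>j. t * (x(0 := 1)) j)" for x by auto
      have "nz_count J (\<lambda>x. G y (x(0 := t))) = nz_count J (\<lambda>x. G y ((\<lambda>j. t * x j)(0 := t)))"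
        by (rule nz_count_scale[OF t, symmetric])
      also have "\<dots> = nz_count J (\<lambda>x. t ^ k * P y x)"
        by (simp only: upd G_scale G_1)
      also have "\<dots> = nz_count J (P y)" using t by (simp add: nz_count_def)
      finally show ?thesis .
    qed
    have nz_G: "nz_count {..m} (G y) = nz_count J (P 0) + (?q - 1) * nz_count J (P y)" for y
    proof -
      have "nz_count {..m} (G y) = (\<Sum>t\<in>UNIV. nz_count J (\<lambda>x. G y (x(0 := t))))"
        unfolding J(1) by (rule nz_count_slices[OF J(2,3)])
      also have "\<dots> = nz_count J (\<lambda>x. G y (x(0 := 0))) + (\<Sum>t\<in>UNIV - {0}. nz_count J (\<lambda>x. G y (x(0 := t))))"
        by (rule sum.remove) auto
      also have "(\<Sum>t\<in>UNIV - {0}. nz_count J (\<lambda>x. G y (x(0 := t)))) = (\<Sum>t\<in>UNIV - {0 :: 'a}. nz_count J (P y))"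
        by (intro sum.cong refl nz_slice) simp
      also have "\<dots> = (?q - 1) * nz_count J (P y)" by (simp add: card_Diff_subset)
      finally show ?thesis by (simp only: G_0)
    qed
    \<comment> \<open>Summing Serre's bound over \<open>y \<noteq> 0\<close> counts the common part
      at infinity q - 1 times and each slice \<open>P y\<close> q - 1 times, which is exactly q - 1
      times the count for \<open>F\<close>.\<close>
    have "(?q - 1) * ((?q - 1) * (?q - (k - 1)) * ?q ^ card {..m}) =
        (\<Sum>y\<in>UNIV - {0 :: 'a}. (?q - 1) * (?q - (k - 1)) * ?q ^ card {..m})"
      by (simp add: card_Diff_subset)
    also have "\<dots> \<le> (\<Sum>y\<in>UNIV - {0 :: 'a}. ?q\<^sup>2 * nz_count {..m} (G y))"
      by (intro sum_mono G_cone) auto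
    also have "\<dots> = ?q\<^sup>2 * (\<Sum>y\<in>UNIV - {0 :: 'a}. nz_count J (P 0) + (?q - 1) * nz_count J (P y))"
      by (simp only: nz_G sum_distrib_left)
    also have "\<dots> = ?q\<^sup>2 * ((?q - 1) * nz_count {..m} F)"
      unfolding nz_F by (simp add: sum.distrib card_Diff_subset distrib_left flip: sum_distrib_left)
    finally have "(?q - 1) * (?q\<^sup>2 * ((?q - 1) * (?q - (k - 1)) * ?q ^ (m - 1))) \<le>
        (?q - 1) * (?q\<^sup>2 * nz_count {..m} F)"
      by (simp add: qm mult_ac power2_eq_square)
    thus ?thesis using q by (simp only: mult_le_cancel1) auto
  qed
qed

section \<open>Rational points\<close>

text \<open>X^q - X has at most q roots, and the image of the base field already supplies q of
  them.\<close>

lemma power_card_eq_self_imp_range_to_ac: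
  fixes y :: "'a :: finite_field alg_closure"
  assumes "y ^ CARD('a) = y"
  shows "y \<in> range to_ac"
proof -
  have inj: "inj (to_ac :: 'a \<Rightarrow> _)" by (rule inj_to_ac)
  define p :: "'a alg_closure poly" where "p = monom 1 CARD('a) - monom 1 1"
  have q: "CARD('a) \<ge> 2" by (rule CARD_finite_field_ge_2)
  have "coeff p CARD('a) \<noteq> 0" using q by (simp add: p_def)
  hence p: "p \<noteq> 0" by auto
  have "Polynomial.degree p \<le> CARD('a)"
    unfolding p_def using q by (intro Polynomial.degree_diff_le) (auto simp: Polynomial.degree_monom_eq)
  hence "card {z. poly p z = 0} \<le> card (range (to_ac :: 'a \<Rightarrow> _))"
    using card_poly_roots_bound[OF p] card_image[OF inj] by simp
  moreover have "to_ac x ^ CARD('a) = to_ac x" for x :: 'a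
    by (metis to_ac_power finite_field_power_card_eq_same)
  hence "range (to_ac :: 'a \<Rightarrow> _) \<subseteq> {z. poly p z = 0}"
    by (auto simp: p_def poly_monom)
  ultimately have "range (to_ac :: 'a \<Rightarrow> _) = {z. poly p z = 0}"
    by (intro card_seteq poly_roots_finite p)
  thus ?thesis using assms by (simp add: p_def poly_monom)
qed

lemma power_Gcd_eq_1:
  fixes l :: "'a :: field"
  assumes "finite S" "\<And>n. n \<in> S \<Longrightarrow> l ^ n = 1"
  shows "l ^ Gcd S = 1"
  using assms
proof (induction S)
  case (insert n S)
  have "l ^ gcd a b = 1" if ab: "l ^ a = 1" "l ^ b = 1" for a b
  proof (cases "a = 0")
    case False
    then obtain x y where "a * x = b * y + gcd a b" using bezout_nat by blast
    hence "l ^ (a * x) = l ^ (b * y) * l ^ gcd a b" by (simp add: power_add)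
    thus ?thesis using ab by (simp add: power_mult)
  qed (use ab in simp)
  thus ?case using insert by simp
qed simp

text \<open>Hilbert 90 for the multiplicative group, by extracting a \<open>(q - 1)\<close>-th root of the factor
  through which Frobenius acts on a representative.\<close>

lemma rational_point_representative:
  fixes P :: "(nat \<Rightarrow> 'a :: finite_field alg_closure) set"
  assumes "P \<in> rational_points m w"
  obtains y where "y \<in> nonzero_vectors m" "P = wproj_rel m w `` {y}" "\<And>i. y i ^ CARD('a) = y i"
proof -
  let ?q = "CARD('a)"
  note eq = equiv_wproj_rel[of m w, where ?'a = 'a]
  have q: "?q \<ge> 2" by (rule CARD_finite_field_ge_2)
  from assms obtain x where x: "x \<in> nonzero_vectors m" "P = wproj_rel m w `` {x}"
      and fix_P: "wproj_frobenius m w P = P"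
    by (auto simp: rational_points_def wproj_space_def quotient_def)
  have "frobenius x \<in> nonzero_vectors m"
    using x(1) q by (auto simp: nonzero_vectors_def frobenius_def fun_eq_iff)
  hence "frobenius x \<in> wproj_rel m w `` {frobenius x}" by (rule equiv_class_self[OF eq])
  moreover have "wproj_rel m w `` {frobenius x} = wproj_rel m w `` {x}"
    using fix_P wproj_frobenius_class[OF x(1), of w] by (simp add: x(2))
  ultimately have "(x, frobenius x) \<in> wproj_rel m w" by (simp only: Image_singleton_iff)
  then obtain l where l: "l \<noteq> 0" "frobenius x = weighted_scale w l x" by (auto simp: wproj_rel_def)
  obtain r where r: "r ^ (?q - 1) = inverse l"
    using nth_root_exists[of "?q - 1" "inverse l"] q by auto
  have r0: "r \<noteq> 0" using r l(1) q by (auto simp: power_0_left)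
  have rq: "r ^ ?q * l = r"
  proof -
    have "r ^ ?q = r * r ^ (?q - 1)" using q by (metis Suc_diff_1 not_numeral_le_zero not_gr0 power_Suc)
    thus ?thesis using r l(1) by simp
  qed
  define y where "y = weighted_scale w r x"
  have y: "y \<in> nonzero_vectors m" unfolding y_def by (intro weighted_scale_in_nonzero_vectors x r0)
  hence "(x, y) \<in> wproj_rel m w" using x(1) r0 by (auto simp: wproj_rel_def y_def)
  hence "P = wproj_rel m w `` {y}" unfolding x(2) by (rule equiv_class_eq[OF eq])
  moreover have "y i ^ ?q = y i" for i
  proof -
    have "x i ^ ?q = l ^ w i * x i" using l(2) by (auto simp: frobenius_def weighted_scale_def fun_eq_iff)
    hence "y i ^ ?q = (r ^ ?q * l) ^ w i * x i"
      by (simp add: y_def weighted_scale_def power_mult_distrib mult.commute flip: power_mult)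
    thus ?thesis by (simp add: rq y_def weighted_scale_def)
  qed
  ultimately show ?thesis using y that by blast
qed

text \<open>Take a Frobenius-fixed representative \<open>y\<close> and the gcd \<open>g\<close> of
  the weights of its nonzero coordinates. A scalar whose \<open>g\<close>-th power \<open>t\<close>
  is a nonzero base field element keeps the coordinates in the base field, and by
  \<open>power_Gcd_eq_1\<close> the resulting vector determines \<open>t\<close>.\<close>

lemma card_rational_representatives:
  fixes P :: "(nat \<Rightarrow> 'a :: finite_field alg_closure) set"
  assumes "P \<in> rational_points m w" "\<forall>i\<le>m. w i > 0"
  shows "CARD('a) - 1 \<le> card {x \<in> vecs {..m}. (\<lambda>i. to_ac (x i)) \<in> P}"
proof -
  let ?q = "CARD('a)"
  obtain y where y: "y \<in> nonzero_vectors m" "P = wproj_rel m w `` {y}" "\<And>i. y i ^ CARD('a) = y i"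
    using rational_point_representative[OF assms(1)] by blast
  define S where "S = {i. y i \<noteq> 0}"
  have S: "S \<subseteq> {..m}" using y(1) by (force simp: S_def nonzero_vectors_def)
  define g where "g = Gcd (w ` S)"
  from y(1) obtain i0 where i0: "i0 \<in> S" by (auto simp: nonzero_vectors_def S_def fun_eq_iff)
  have g_dvd: "g dvd w i" if "i \<in> S" for i using that by (simp add: g_def)
  have "w i0 > 0" using i0 S assms(2) by auto
  hence g: "g > 0" using g_dvd[OF i0] by (auto intro: Nat.gr0I)
  have "\<exists>r. r ^ g = to_ac t" for t :: 'a using nth_root_exists[OF g] by blast
  then obtain r where r: "\<And>t :: 'a. r t ^ g = to_ac t" by metis
  have r0: "r t \<noteq> 0" if "t \<noteq> 0" for t :: 'a
    using r[of t] that g by (auto simp: power_0_left)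
  define z where "z = (\<lambda>t. weighted_scale w (r t) y)"
  define \<phi> where "\<phi> = (\<lambda>t i. of_ac (z t i))"
  have to_ac_\<phi>: "to_ac (\<phi> t i) = z t i" for t i
  proof (cases "i \<in> S")
    case True
    then obtain n where "w i = g * n" using g_dvd by blast
    hence "r t ^ w i = to_ac (t ^ n)" by (simp add: power_mult r)
    hence "(r t ^ w i) ^ ?q = r t ^ w i" by (metis to_ac_power finite_field_power_card_eq_same)
    hence "z t i ^ ?q = z t i" by (simp add: z_def weighted_scale_def power_mult_distrib y(3))
    thus ?thesis unfolding \<phi>_def by (intro to_ac_of_ac power_card_eq_self_imp_range_to_ac)
  next
    case False
    hence "z t i = 0" by (simp add: z_def S_def weighted_scale_def)
    thus ?thesis unfolding \<phi>_def by (intro to_ac_of_ac) (metis rangeI to_ac_0)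
  qed
  have "inj_on \<phi> (UNIV - {0})"
  proof (rule inj_onI)
    fix t s :: 'a
    assume ts: "t \<in> UNIV - {0}" "s \<in> UNIV - {0}" "\<phi> t = \<phi> s"
    have "z t i = z s i" for i using ts(3) to_ac_\<phi> by metis
    hence "(r t / r s) ^ w i = 1" if "i \<in> S" for i
      using that r0[of s] ts(2) by (auto simp: z_def weighted_scale_def S_def power_divide)
    hence "(r t / r s) ^ g = 1"
      unfolding g_def using finite_subset[OF S] by (intro power_Gcd_eq_1) auto
    thus "t = s" using r0[of s] ts(2) by (simp add: power_divide r)
  qed
  hence "card (\<phi> ` (UNIV - {0})) = ?q - 1" by (simp add: card_image card_Diff_subset)
  moreover have "\<phi> t \<in> {x \<in> vecs {..m}. (\<lambda>i. to_ac (x i)) \<in> P}" if "t \<noteq> 0" for t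
  proof -
    have "\<phi> t i = 0" if "i > m" for i
      using to_ac_\<phi>[of t i] y(1) that by (simp add: z_def weighted_scale_def nonzero_vectors_def)
    moreover have "z t \<in> P"
      using y(1) r0[OF that] weighted_scale_in_nonzero_vectors[OF y(1) r0[OF that], of w]
      by (auto simp: y(2) wproj_rel_def z_def)
    ultimately show ?thesis by (auto simp: vecs_def to_ac_\<phi>)
  qed
  hence "\<phi> ` (UNIV - {0}) \<subseteq> {x \<in> vecs {..m}. (\<lambda>i. to_ac (x i)) \<in> P}" by blast
  moreover have "finite {x \<in> vecs {..m}. (\<lambda>i. to_ac (x i :: 'a)) \<in> P}" by simp
  ultimately show ?thesis using card_mono by metis
qed

section \<open>Passing from points to vectors over the base field\<close>

text \<open>The product runs over all of \<open>{..m}\<close>, with exponent 0 for absent variables,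
  to match the shape of \<open>nz_count_weighted_form\<close>.\<close>

definition base_eval :: "nat \<Rightarrow> 'a :: finite_field mpoly \<Rightarrow> (nat \<Rightarrow> 'a) \<Rightarrow> 'a" where
  "base_eval m f = (\<lambda>x. \<Sum>a\<in>Poly_Mapping.keys f.
     Poly_Mapping.lookup f a * (\<Prod>j\<le>m. x j ^ Poly_Mapping.lookup a j))"

lemma mpoly_eval_to_ac:
  assumes "f \<in> weighted_forms m w d"
  shows "mpoly_eval f (\<lambda>i. to_ac (x i)) = to_ac (base_eval m f x)"
proof -
  have "(\<Prod>i\<in>Poly_Mapping.keys a. to_ac (x i) ^ Poly_Mapping.lookup a i) =
      to_ac (\<Prod>j\<le>m. x j ^ Poly_Mapping.lookup a j)" if "a \<in> Poly_Mapping.keys f" for a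
  proof -
    have "Poly_Mapping.keys a \<subseteq> {..m}"
      using assms that by (auto simp: weighted_forms_iff weighted_exponents_def)
    thus ?thesis
      unfolding to_ac_prod to_ac_power by (intro prod.mono_neutral_left) (auto simp: in_keys_iff)
  qed
  thus ?thesis by (simp add: mpoly_eval_def base_eval_def to_ac_sum)
qed

lemma base_eval_zero:
  assumes "f \<in> weighted_forms m w d" "d \<ge> 1"
  shows "base_eval m f (\<lambda>_. 0) = 0"
proof -
  have zero: "(\<Prod>j\<le>m. (0 :: 'a) ^ Poly_Mapping.lookup a j) = 0" if "a \<in> Poly_Mapping.keys f" for a
  proof -
    have "(\<Sum>i\<le>m. w i * Poly_Mapping.lookup a i) = d"
      using assms(1) that by (auto simp: weighted_forms_iff weighted_exponents_def)
    with assms(2) have "\<exists>i\<le>m. Poly_Mapping.lookup a i \<noteq> 0"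
      by (metis (no_types, lifting) atMost_iff mult_0_right not_one_le_zero sum.neutral)
    thus ?thesis by (auto simp: power_0_left)
  qed
  show ?thesis unfolding base_eval_def by (intro sum.neutral ballI) (simp only: zero mult_zero_right)
qed

text \<open>Distinct points are disjoint orbits, each with at least q - 1 vectors over the base
  field, all of them zeros of the form. The origin lies in no orbit but is a zero because
  \<open>d \<ge> 1\<close>; it accounts for the summand 1.\<close>

lemma card_zero_locus:
  fixes f :: "'a :: finite_field mpoly"
  assumes f: "f \<in> weighted_forms m w d" and d: "d \<ge> 1" and w: "\<forall>i\<le>m. w i > 0"
  shows "(CARD('a) - 1) * card (zero_locus m w f) + nz_count {..m} (base_eval m f) + 1 \<le> CARD('a) ^ (m + 1)"
proof -
  let ?q = "CARD('a)"
  let ?Z = "zero_locus m w f"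
  note eq = equiv_wproj_rel[of m w, where ?'a = 'a]
  define R where "R = (\<lambda>P. {x \<in> vecs {..m}. (\<lambda>i. to_ac (x i :: 'a)) \<in> P})"
  have q: "?q \<ge> 2" by (rule CARD_finite_field_ge_2)
  have quot: "P \<in> nonzero_vectors m // wproj_rel m w" if "P \<in> ?Z" for P
    using that by (auto simp: zero_locus_def rational_points_def wproj_space_def)
  have card_R: "?q - 1 \<le> card (R P)" if "P \<in> ?Z" for P
    unfolding R_def using that w by (intro card_rational_representatives) (auto simp: zero_locus_def)
  have disj: "R P \<inter> R Q = {}" if "P \<in> ?Z" "Q \<in> ?Z" "P \<noteq> Q" for P Q
    using quotient_disj[OF eq quot[OF that(1)] quot[OF that(2)]] that(3) by (auto simp: R_def)
  have fin: "finite ?Z"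
  proof (rule finite_surj)
    show "?Z \<subseteq> (\<lambda>x. wproj_rel m w `` {\<lambda>i. to_ac (x i :: 'a)}) ` vecs {..m}"
    proof
      fix P assume P: "P \<in> ?Z"
      have "R P \<noteq> {}" using card_R[OF P] q by auto
      then obtain x where x: "x \<in> vecs {..m}" "(\<lambda>i. to_ac (x i)) \<in> P" by (auto simp: R_def)
      have "P = wproj_rel m w `` {\<lambda>i. to_ac (x i)}"
        using quot[OF P] x(2) eq by (metis Image_singleton_iff equiv_class_eq quotientE)
      with x(1) show "P \<in> (\<lambda>x. wproj_rel m w `` {\<lambda>i. to_ac (x i :: 'a)}) ` vecs {..m}" by blast
    qed
  qed simp
  have "(?q - 1) * card ?Z \<le> (\<Sum>P\<in>?Z. card (R P))"
    using sum_mono[of ?Z "\<lambda>_. ?q - 1", OF card_R] by (simp add: mult.commute)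
  also have "\<dots> = card (\<Union>P\<in>?Z. R P)"
    using fin disj by (intro card_UN_disjoint[symmetric]) (auto simp: R_def)
  also have "\<dots> \<le> card ({x \<in> vecs {..m}. base_eval m f x = 0} - {\<lambda>_. 0})"
  proof (rule card_mono)
    show "(\<Union>P\<in>?Z. R P) \<subseteq> {x \<in> vecs {..m}. base_eval m f x = 0} - {\<lambda>_. 0}"
    proof
      fix x assume "x \<in> (\<Union>P\<in>?Z. R P)"
      then obtain P where P: "P \<in> ?Z" "x \<in> vecs {..m}" "(\<lambda>i. to_ac (x i)) \<in> P" by (auto simp: R_def)
      have "mpoly_eval f (\<lambda>i. to_ac (x i)) = 0" using P by (auto simp: zero_locus_def)
      hence "base_eval m f x = 0" by (simp add: mpoly_eval_to_ac[OF f])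
      moreover have "(\<lambda>i. to_ac (x i)) \<in> nonzero_vectors m"
        using in_quotient_imp_subset[OF eq quot[OF P(1)]] P(3) by blast
      hence "x \<noteq> (\<lambda>_. 0)" by (auto simp: nonzero_vectors_def)
      ultimately show "x \<in> {x \<in> vecs {..m}. base_eval m f x = 0} - {\<lambda>_. 0}" using P(2) by simp
    qed
  qed simp
  also have "\<dots> = card {x \<in> vecs {..m}. base_eval m f x = 0} - 1"
    using base_eval_zero[OF f d] by (subst card_Diff_subset) auto
  finally have "(?q - 1) * card ?Z \<le> card {x \<in> vecs {..m}. base_eval m f x = 0} - 1" .
  moreover have "card {x \<in> vecs {..m}. base_eval m f x = 0} \<ge> 1"
  proof -
    have "(\<lambda>_. 0) \<in> {x \<in> vecs {..m}. base_eval m f x = 0}" using base_eval_zero[OF f d] by simp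
    thus ?thesis by (auto simp del: mem_Collect_eq simp: Suc_le_eq card_gt_0_iff)
  qed
  moreover have "card {x \<in> vecs {..m}. base_eval m f x = 0} + nz_count {..m} (base_eval m f) = ?q ^ (m + 1)"
  proof -
    have "card {x \<in> vecs {..m}. base_eval m f x = 0} + nz_count {..m} (base_eval m f) =
        card ({x \<in> vecs {..m}. base_eval m f x = 0} \<union> {x \<in> vecs {..m}. base_eval m f x \<noteq> 0})"
      unfolding nz_count_def by (rule card_Un_disjoint[symmetric]) auto
    also have "{x \<in> vecs {..m}. base_eval m f x = 0} \<union> {x \<in> vecs {..m}. base_eval m f x \<noteq> 0} = vecs {..m}"
      by auto
    finally show ?thesis by (simp add: card_vecs)
  qed
  ultimately show ?thesis by linarith
qed

lemma card_zero_locus_le: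
  fixes f :: "'a :: finite_field mpoly"
  assumes m: "m \<ge> 1" and w: "\<forall>i\<le>m. w i > 0" and w_mono: "\<And>i. 1 \<le> i \<Longrightarrow> i \<le> m \<Longrightarrow> w 1 \<le> w i"
    and d: "d \<ge> 1" and f: "f \<in> weighted_forms m w d" "f \<noteq> 0"
  shows "card (zero_locus m w f) \<le>
           min (proj_count CARD('a) (int m))
               (((d - 1) div w 1 + 1) * CARD('a) ^ (m - 1) + proj_count CARD('a) (int m - 2))"
proof -
  let ?q = "CARD('a)"
  let ?Z = "card (zero_locus m w f)"
  define k where "k = (d - 1) div w 1 + 1"
  define p where "p = proj_count ?q (int m)"
  define p' where "p' = proj_count ?q (int m - 2)"
  have q: "?q \<ge> 2" by (rule CARD_finite_field_ge_2)
  have p_sum: "p = (\<Sum>i<m + 1. ?q ^ i)"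
    using proj_count_geometric[OF q, of "m + 1"] unfolding p_def by simp
  \<comment> \<open>For \<open>m = 1\<close> the index is -1 and the sum over
    \<open>i < m - 1\<close> is empty.\<close>
  have "int m - 2 = int (m - 1) - 1" using m by simp
  hence p'_sum: "p' = (\<Sum>i<m - 1. ?q ^ i)"
    using proj_count_geometric[OF q, of "m - 1"] unfolding p'_def by (simp only:)
  \<comment> \<open>The gap between \<open>p\<close> and the bound is thus (q + 1 - k) q^(m-1): for
    \<open>k \<le> ?q\<close> this is what \<open>nz_count_weighted_form\<close> provides, and for
    \<open>k > ?q\<close> the bound is at least \<open>p\<close>.\<close>
  have pp': "p = (?q + 1) * ?q ^ (m - 1) + p'"
    using m unfolding p_sum p'_sum by (cases m) auto
  have "int ((?q - 1) * p + 1) = int (?q ^ (m + 1))"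
    using q power_diff_1_eq[of "int ?q" "m + 1"] unfolding p_sum by (simp add: of_nat_diff)
  hence qp: "(?q - 1) * p + 1 = ?q ^ (m + 1)" by (simp only: of_nat_eq_iff)
  have le: "(?q - 1) * ?Z + nz_count {..m} (base_eval m f) \<le> (?q - 1) * p"
    using card_zero_locus[OF f(1) d w] qp by linarith
  hence "(?q - 1) * ?Z \<le> (?q - 1) * p" by linarith
  hence Z_p: "?Z \<le> p" using q by (simp only: mult_le_cancel1)
  have "?Z \<le> k * ?q ^ (m - 1) + p'"
  proof (cases "k \<le> ?q")
    case False
    hence "(?q + 1) * ?q ^ (m - 1) \<le> k * ?q ^ (m - 1)" by (intro mult_right_mono) auto
    thus ?thesis using Z_p pp' by linarith
  next
    case True
    have w1: "w 1 > 0" using m w by simp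
    have "d - 1 < k * w 1"
      using dividend_less_div_times[OF w1, of "d - 1"] unfolding k_def by (simp only: add_mult_distrib mult_1 add.commute)
    hence dk: "d \<le> k * w 1" by linarith
    have inj: "a = b" if ab: "a \<in> Poly_Mapping.keys f" "b \<in> Poly_Mapping.keys f"
      "\<And>j. j \<le> m \<Longrightarrow> Poly_Mapping.lookup a j = Poly_Mapping.lookup b j" for a b
    proof (rule poly_mapping_eqI)
      fix j
      have "Poly_Mapping.keys a \<subseteq> {..m}" "Poly_Mapping.keys b \<subseteq> {..m}"
        using f(1) ab by (auto simp: weighted_forms_iff weighted_exponents_def)
      thus "Poly_Mapping.lookup a j = Poly_Mapping.lookup b j"
        using ab(3)[of j] by (metis atMost_iff in_keys_iff subsetD)
    qed
    have "(?q - 1) * (?q - (k - 1)) * ?q ^ (m - 1) \<le> nz_count {..m} (base_eval m f)"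
      unfolding base_eval_def
    proof (rule nz_count_weighted_form[where w = w and d = d and c = "Poly_Mapping.lookup f"
          and e = Poly_Mapping.lookup, OF m _ w1 w_mono _ _ _ _ inj _ True dk])
      show "(\<Sum>i\<le>m. w i * Poly_Mapping.lookup a i) = d" if "a \<in> Poly_Mapping.keys f" for a
        using f(1) that by (auto simp: weighted_forms_iff weighted_exponents_def)
    qed (use w f(2) in \<open>auto simp: k_def in_keys_iff\<close>)
    with le have "(?q - 1) * (?Z + (?q - (k - 1)) * ?q ^ (m - 1)) \<le> (?q - 1) * p"
      by (simp add: distrib_left mult.assoc)
    hence Z: "?Z + (?q - (k - 1)) * ?q ^ (m - 1) \<le> p" using q by (simp only: mult_le_cancel1)
    have "?q + 1 = (?q - (k - 1)) + k" using True by (simp add: k_def)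
    hence "p = (?q - (k - 1)) * ?q ^ (m - 1) + k * ?q ^ (m - 1) + p'"
      unfolding pp' by (simp only: add_mult_distrib)
    with Z show ?thesis by linarith
  qed
  with Z_p show ?thesis by (simp add: k_def p_def p'_def)
qed

theorem proposition4p6:
  fixes m d :: nat and w :: "nat \<Rightarrow> nat"
  assumes "m \<ge> 1"
    and "\<forall>i\<le>m. w i > 0"
    and "\<forall>i j. 1 \<le> i \<and> i \<le> j \<and> j \<le> m \<longrightarrow> w i \<le> w j"
    and "\<forall>i. 1 \<le> i \<and> i \<le> m \<longrightarrow> gcd (w 0) (gcd (w i) (CARD('a :: finite_field) - 1)) = 1"
    and "d \<ge> 1"
    and "\<exists>c :: nat \<Rightarrow> nat. d = (\<Sum>i\<le>m. c i * w i)"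
  shows "max_zeros TYPE('a) m w d \<le>
           min (proj_count CARD('a) (int m))
               (((d - 1) div w 1 + 1) * CARD('a) ^ (m - 1) + proj_count CARD('a) (int m - 2))"
proof -
  let ?B = "min (proj_count CARD('a) (int m))
               (((d - 1) div w 1 + 1) * CARD('a) ^ (m - 1) + proj_count CARD('a) (int m - 2))"
  let ?C = "{card (zero_locus m w f) | f :: 'a mpoly. f \<in> weighted_forms m w d \<and> f \<noteq> 0}"
  have bound: "n \<le> ?B" if "n \<in> ?C" for n
    using that card_zero_locus_le[where 'a = 'a, OF assms(1,2) _ assms(5)] assms(3) by blast
  \<comment> \<open>The representation of \<open>d\<close> by the weights gives a monomial of
    weighted degree \<open>d\<close>, so that \<open>Max\<close> is not taken over the empty
    set.\<close>
  obtain c where c: "d = (\<Sum>i\<le>m. c i * w i)" using assms(6) by blast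
  define a where "a = Poly_Mapping.Abs_poly_mapping (\<lambda>i. c i when i \<le> m)"
  have lookup_a: "Poly_Mapping.lookup a = (\<lambda>i. c i when i \<le> m)"
    unfolding a_def by (rule Poly_Mapping.lookup_Abs_poly_mapping) (auto simp: when_def)
  have "a \<in> weighted_exponents m w d"
    by (auto simp: weighted_exponents_def in_keys_iff lookup_a when_def c mult.commute split: if_splits)
  hence "Poly_Mapping.single a (1 :: 'a) \<in> weighted_forms m w d" by (simp add: weighted_forms_iff)
  moreover have "Poly_Mapping.lookup (Poly_Mapping.single a (1 :: 'a)) a \<noteq> 0" by simp
  hence "Poly_Mapping.single a (1 :: 'a) \<noteq> 0" by (metis lookup_zero)
  ultimately have nonempty: "?C \<noteq> {}" by blast
  \<comment> \<open>The bound itself makes the set of values finite.\<close>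
  have "?C \<subseteq> {..?B}" using bound by (intro subsetI) (simp only: atMost_iff)
  hence "finite ?C" by (rule finite_subset) simp
  thus ?thesis unfolding max_zeros_def by (rule Max.boundedI[OF _ nonempty bound])
qed

end
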